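(* Let $(X_n,\mathsf d_n,\mathfrak m_n,\bar x_n)$, $n\in\bar{\mathbb N}=\mathbb N\cup\{\infty\}$, be pointed metric measure spaces. Assume that (i) $[X_n,\mathsf d_n,\mathfrak m_n,\bar x_n]\to[X_\infty,\mathsf d_\infty,\mathfrak m_\infty,\bar x_\infty]$ in the pointed measured Gromov (pmG) sense; (ii) $\operatorname{supp}(\mathfrak m_\infty)=X_\infty$; (iii) for some $\mathsf c>0$ the spaces $(X_n,\mathsf d_n,\mathfrak m_n)$ are all $\mathsf c$-doubling. Then $(X_n,\mathsf d_n,\mathfrak m_n,\bar x_n)\to(X_\infty,\mathsf d_\infty,\mathfrak m_\infty,\bar x_\infty)$ in the pointed measured Gromov–Hausdorff (pmGH) sense.
   Context: A pointed metric measure (p.m.m.) space $(X,\mathsf d,\mathfrak m,\bar x)$ consists of a complete separable metric space $(X,\mathsf d)$, a nonzero nonnegative Borel measure $\mathfrak m$ finite on bounded sets, and a point $\bar x\in\operatorname{supp}(\mathfrak m)$. Two p.m.m. spaces are isomorphic if there is an isometric embedding $\iota:\operatorname{supp}(\mathfrak m_1)\to X_2$ with $\iota_\sharp\mathfrak m_1=\mathfrak m_2$ and $\iota(\bar x_1)=\bar x_2$; $[X,\mathsf d,\mathfrak m,\bar x]$ denotes the isomorphism class. Weak convergence of measures finite on bounded sets is convergence of integrals of bounded continuous functions with bounded support. $(X,\mathsf d,\mathfrak m)$ is $\mathsf c$-doubling if $\mathfrak m(B_{2R}(x))\le\mathsf c\,\mathfrak m(B_R(x))$ for all $x\in X$,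 $R>0$. pmG convergence: $[X_n,\mathsf d_n,\mathfrak m_n,\bar x_n]\to[X_\infty,\mathsf d_\infty,\mathfrak m_\infty,\bar x_\infty]$ if there are a complete separable metric space $(X,\mathsf d)$ and isometric embeddings $\iota_n:X_n\to X$, $n\in\bar{\mathbb N}$, such that $(\iota_n)_\sharp\mathfrak m_n\to(\iota_\infty)_\sharp\mathfrak m_\infty$ weakly and $\iota_n(\bar x_n)\to\iota_\infty(\bar x_\infty)$ in $X$. (This does not depend on the chosen representatives.) pmGH convergence: for every $\varepsilon,R>0$ there is $N(\varepsilon,R)\in\mathbb N$ such that for all $n\ge N(\varepsilon,R)$ there is a Borel map $f_n^{R,\varepsilon}:B_R(\bar x_n)\to X_\infty$ such that: - $f_n^{R,\varepsilon}(\bar x_n)=\bar x_\infty$; - $\sup_{x,y\in B_R(\bar x_n)}|\mathsf d_n(x,y)-\mathsf d_\infty(f_n^{R,\varepsilon}(x),f_n^{R,\varepsilon}(y))|\le\varepsilon$; - the $\varepsilon$-neighbourhood of $f_n^{R,\varepsilon}(B_R(\bar x_n))$ contains $B_{R-\varepsilon}(\bar x_\infty)$; - $(f_n^{R,\varepsilon})_\sharp(\mathfrak m_n|_{B_R(\bar x_n)})$ weakly converges to $\mathfrak m_\infty|_{B_R(\bar x_\infty)}$ as $n\to\infty$, for a.e. $R>0$. *)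

theory Defs
  imports "HOL-Analysis.Analysis" "HOL-Library.Extended_Nat"
begin

definition metric_borel :: "'a metric \<Rightarrow> 'a measure" where
  "metric_borel X = sigma (mspace X) {U. openin (mtopology_of X) U}"

definition metric_support :: "'a metric \<Rightarrow> 'a measure \<Rightarrow> 'a set" where
  "metric_support X m =
     {x \<in> mspace X. \<forall>U. openin (mtopology_of X) U \<and> x \<in> U \<longrightarrow> 0 < emeasure m U}"

definition complete_separable :: "'a metric \<Rightarrow> bool" where
  "complete_separable X \<longleftrightarrow> mcomplete_of X \<and> separable_space (mtopology_of X)"

definition bounded_in :: "'a metric \<Rightarrow> 'a set \<Rightarrow> bool" where
  "bounded_in X S \<longleftrightarrow> Metric_space.mbounded (mspace X) (mdist X) S"

definition pmm_space :: "'a metric \<Rightarrow> 'a measure \<Rightarrow> 'a \<Rightarrow> bool" where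
  "pmm_space X m a \<longleftrightarrow>
     complete_separable X \<and>
     sets m = sets (metric_borel X) \<and>
     emeasure m (space m) \<noteq> 0 \<and>
     (\<forall>A\<in>sets m. bounded_in X A \<longrightarrow> emeasure m A < \<infinity>) \<and>
     a \<in> metric_support X m"

definition doubling :: "real \<Rightarrow> 'a metric \<Rightarrow> 'a measure \<Rightarrow> bool" where
  "doubling c X m \<longleftrightarrow>
     (\<forall>x\<in>mspace X. \<forall>R>0.
        emeasure m (mball_of X x (2 * R)) \<le> ennreal c * emeasure m (mball_of X x R))"

definition isometric_embedding :: "'a metric \<Rightarrow> 'b metric \<Rightarrow> ('a \<Rightarrow> 'b) \<Rightarrow> bool" where
  "isometric_embedding X Y f \<longleftrightarrow>
     f \<in> mspace X \<rightarrow> mspace Y \<and>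
     (\<forall>x\<in>mspace X. \<forall>y\<in>mspace X. mdist Y (f x) (f y) = mdist X x y)"

text \<open>The measures below are meant to be Borel measures on \<open>X\<close>, finite on bounded sets, so that
  all the integrals are finite.\<close>

definition weakly_converges :: "'a metric \<Rightarrow> (nat \<Rightarrow> 'a measure) \<Rightarrow> 'a measure \<Rightarrow> bool" where
  "weakly_converges X \<mu> \<nu> \<longleftrightarrow>
     (\<forall>\<phi>::'a \<Rightarrow> real.
        continuous_map (mtopology_of X) euclideanreal \<phi> \<and>
        bounded (\<phi> ` mspace X) \<and>
        bounded_in X {x \<in> mspace X. \<phi> x \<noteq> 0} \<longrightarrow>
        (\<lambda>n. integral\<^sup>L (\<mu> n) \<phi>) \<longlonglongrightarrow> integral\<^sup>L \<nu> \<phi>)"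

text \<open>Sequences are indexed by \<open>enat\<close>, the limit space having index \<open>\<infinity>\<close>. The common ambient space
  of the embeddings is a metric on a subset of the type \<open>'z\<close>. HOL cannot quantify existentially
  over types; in a premise, a free \<open>'z\<close> says that the ambient space may live on any type.\<close>

definition pmG_converges ::
    "'z itself \<Rightarrow> (enat \<Rightarrow> 'a metric) \<Rightarrow> (enat \<Rightarrow> 'a measure) \<Rightarrow> (enat \<Rightarrow> 'a) \<Rightarrow> bool" where
  "pmG_converges (_ :: 'z itself) X m a \<longleftrightarrow>
     (\<exists>(Z :: 'z metric) (\<iota> :: enat \<Rightarrow> 'a \<Rightarrow> 'z).
        complete_separable Z \<and>
        (\<forall>n. isometric_embedding (X n) Z (\<iota> n)) \<and>
        weakly_converges Z
          (\<lambda>n. distr (m (enat n)) (metric_borel Z) (\<iota> (enat n)))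
          (distr (m \<infinity>) (metric_borel Z) (\<iota> \<infinity>)) \<and>
        limitin (mtopology_of Z) (\<lambda>n. \<iota> (enat n) (a (enat n))) (\<iota> \<infinity> (a \<infinity>)) sequentially)"

text \<open>In the last condition the maps are fixed first, and \<open>n \<rightarrow> \<infinity>\<close> with \<open>\<epsilon>\<close> and \<open>R\<close> fixed; the
  indices \<open>n < N \<epsilon> R\<close>, for which \<open>f n R \<epsilon>\<close> is unconstrained, do not affect the limit. The density
  is the measure \<open>A \<mapsto> m\<^sub>\<infinity> (A \<inter> B\<^sub>R)\<close> on the limit space.\<close>

definition pmGH_converges ::
    "(enat \<Rightarrow> 'a metric) \<Rightarrow> (enat \<Rightarrow> 'a measure) \<Rightarrow> (enat \<Rightarrow> 'a) \<Rightarrow> bool" where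
  "pmGH_converges X m a \<longleftrightarrow>
     (\<exists>(N :: real \<Rightarrow> real \<Rightarrow> nat) (f :: nat \<Rightarrow> real \<Rightarrow> real \<Rightarrow> 'a \<Rightarrow> 'a).
        (\<forall>\<epsilon>>0. \<forall>R>0. \<forall>n\<ge>N \<epsilon> R.
           let B = mball_of (X (enat n)) (a (enat n)) R; g = f n R \<epsilon> in
             g \<in> restrict_space (metric_borel (X (enat n))) B \<rightarrow>\<^sub>M metric_borel (X \<infinity>) \<and>
             g (a (enat n)) = a \<infinity> \<and>
             (\<forall>x\<in>B. \<forall>y\<in>B. \<bar>mdist (X (enat n)) x y - mdist (X \<infinity>) (g x) (g y)\<bar> \<le> \<epsilon>) \<and>
             mball_of (X \<infinity>) (a \<infinity>) (R - \<epsilon>) \<subseteq> (\<Union>x\<in>B. mball_of (X \<infinity>) (g x) \<epsilon>)) \<and>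
        (\<forall>\<epsilon>>0. AE R in lborel. R > 0 \<longrightarrow>
           weakly_converges (X \<infinity>)
             (\<lambda>n. distr (restrict_space (m (enat n)) (mball_of (X (enat n)) (a (enat n)) R))
                        (metric_borel (X \<infinity>)) (f n R \<epsilon>))
             (density (m \<infinity>) (indicator (mball_of (X \<infinity>) (a \<infinity>) R)))))"

end

theory Submission
  imports Defs
begin

text \<open>Realise the convergence in an ambient space \<open>Z\<close>. Doubling bounds the mass of small balls in
  \<open>B\<^sub>R(x\<^sub>n)\<close> from below, uniformly in \<open>n\<close>, so testing against the distance to the image of \<open>X\<^sub>\<infinity>\<close>
  shows that \<open>B\<^sub>R(x\<^sub>n)\<close> lies within \<open>\<delta>\<^sub>n \<rightarrow> 0\<close> of that image. Moving each point to the first point of a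
  dense sequence of \<open>X\<^sub>\<infinity>\<close> that is \<open>\<delta>\<^sub>n\<close>-close to it gives Borel maps \<open>g\<^sub>n\<close> that serve every \<open>\<epsilon>\<close>.
  Balls of \<open>X\<^sub>\<infinity>\<close> have finite nets by doubling, whose points are charged by the measures \<open>m\<^sub>n\<close> for
  large \<open>n\<close> because \<open>m\<^sub>\<infinity>\<close> has full support; this gives the covering condition.

  For the weak convergence, \<open>\<phi> \<circ> g\<^sub>n\<close> with \<open>\<phi> \<ge> 0\<close> is bounded below, up to \<open>k \<delta>\<^sub>n\<close>, by the
  \<open>k\<close>-Lipschitz function \<open>z \<mapsto> inf\<^sub>y \<phi>(y) + k d(z, y)\<close> on \<open>Z\<close>, whence
  \<open>lim inf \<integral>\<^bsub>B\<^sub>R(x\<^sub>n)\<^esub> \<phi> \<circ> g\<^sub>n \<ge> \<integral>\<^bsub>B\<^sub>R(x\<^sub>\<infinity>)\<^esub> \<phi>\<close>. Applied to \<open>M \<plusminus> \<phi>\<close>, together with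
  \<open>lim sup m\<^sub>n(B\<^sub>R(x\<^sub>n)) \<le> m\<^sub>\<infinity>(B\<^sub>R(x\<^sub>\<infinity>))\<close> at the continuity points \<open>R\<close> of the right-hand side, that is
  for all but countably many \<open>R\<close>, this yields the limit of \<open>\<integral> \<phi> \<circ> g\<^sub>n\<close>.\<close>

section \<open>Borel sets and continuous maps of metric spaces\<close>

lemma mdist_self [simp]: "x \<in> mspace X \<Longrightarrow> mdist X x x = 0"
  by simp

text \<open>Exchanging the two points turns the one-sided bound into a two-sided one. The one-sided
  form is what the triangle inequality yields directly for distances and for infima of Lipschitz
  functions.\<close>

lemma lipschitz_imp_continuous_map_real:
  fixes f :: "'a \<Rightarrow> real"
  assumes "\<And>x y. \<lbrakk>x \<in> mspace X; y \<in> mspace X\<rbrakk> \<Longrightarrow> f x \<le> f y + L * mdist X x y"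
  shows "continuous_map (mtopology_of X) euclideanreal f"
proof -
  have "\<bar>f x - f y\<bar> \<le> L * mdist X x y" if "x \<in> mspace X" "y \<in> mspace X" for x y
    using assms[OF that] assms[OF that(2,1)] by (simp add: mdist_commute)
  then have "Lipschitz_continuous_map X euclidean_metric f"
    by (auto simp: Lipschitz_continuous_map_def dist_real_def)
  then show ?thesis
    using Lipschitz_continuous_imp_continuous_map by fastforce
qed

lemma space_metric_borel [simp]: "space (metric_borel X) = mspace X"
  unfolding metric_borel_def
  by (rule space_measure_of) (use openin_subset in fastforce)

lemma openin_imp_sets_metric_borel:
  assumes "openin (mtopology_of X) U"
  shows "U \<in> sets (metric_borel X)"
proof -
  have "{U. openin (mtopology_of X) U} \<subseteq> Pow (mspace X)"
    using openin_subset by fastforce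
  then show ?thesis
    using assms by (auto simp: metric_borel_def sets_measure_of)
qed

lemma closedin_imp_sets_metric_borel:
  assumes "closedin (mtopology_of X) C"
  shows "C \<in> sets (metric_borel X)"
proof -
  have "mspace X - (mspace X - C) \<in> sets (metric_borel X)"
    using assms openin_imp_sets_metric_borel[of X "mspace X - C"]
    by (metis closedin_def sets.compl_sets space_metric_borel topspace_mtopology_of)
  then show ?thesis
    using assms closedin_subset by (metis double_diff order_refl topspace_mtopology_of)
qed

lemma continuous_map_imp_borel_measurable:
  fixes f :: "'a \<Rightarrow> real"
  assumes "continuous_map (mtopology_of X) euclideanreal f"
  shows "f \<in> borel_measurable (metric_borel X)"
proof (rule borel_measurableI)
  fix S :: "real set" assume "open S"
  then have "openin (mtopology_of X) {x \<in> mspace X. f x \<in> S}"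
    using openin_continuous_map_preimage[OF assms] by simp
  moreover have "f -` S \<inter> space (metric_borel X) = {x \<in> mspace X. f x \<in> S}"
    by auto
  ultimately show "f -` S \<inter> space (metric_borel X) \<in> sets (metric_borel X)"
    by (simp add: openin_imp_sets_metric_borel)
qed

lemma continuous_map_imp_measurable:
  assumes "continuous_map (mtopology_of X) (mtopology_of Y) f"
  shows "f \<in> metric_borel X \<rightarrow>\<^sub>M metric_borel Y"
  unfolding metric_borel_def[of Y]
proof (rule measurable_measure_of)
  show "{U. openin (mtopology_of Y) U} \<subseteq> Pow (mspace Y)"
    using openin_subset by fastforce
  show "f \<in> space (metric_borel X) \<rightarrow> mspace Y"
    using assms continuous_map_funspace by fastforce
  fix U assume "U \<in> {U. openin (mtopology_of Y) U}"
  then have "openin (mtopology_of X) {x \<in> mspace X. f x \<in> U}"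
    using openin_continuous_map_preimage[OF assms] by simp
  moreover have "f -` U \<inter> space (metric_borel X) = {x \<in> mspace X. f x \<in> U}"
    by auto
  ultimately show "f -` U \<inter> space (metric_borel X) \<in> sets (metric_borel X)"
    by (simp add: openin_imp_sets_metric_borel)
qed

lemma isometric_embedding_measurable:
  assumes "isometric_embedding X Y f"
  shows "f \<in> metric_borel X \<rightarrow>\<^sub>M metric_borel Y"
proof (rule continuous_map_imp_measurable, rule Lipschitz_continuous_imp_continuous_map)
  show "Lipschitz_continuous_map X Y f"
    using assms unfolding isometric_embedding_def Lipschitz_continuous_map_def
    by (intro conjI exI[of _ 1]) auto
qed

section \<open>Continuous cutoffs of balls, used in place of their indicators as test
  functions\<close>

definition ramp :: "'a metric \<Rightarrow> 'a \<Rightarrow> real \<Rightarrow> real \<Rightarrow> 'a \<Rightarrow> real" where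
  "ramp Z z r s w = max 0 (min 1 ((s - mdist Z z w) / (s - r)))"

lemma ramp_nonneg: "0 \<le> ramp Z z r s w"
  and ramp_le_1: "ramp Z z r s w \<le> 1"
  by (auto simp: ramp_def)

lemma ramp_eq_1: "r < s \<Longrightarrow> mdist Z z w \<le> r \<Longrightarrow> ramp Z z r s w = 1"
  by (simp add: ramp_def field_simps)

lemma ramp_eq_0: "r < s \<Longrightarrow> s \<le> mdist Z z w \<Longrightarrow> ramp Z z r s w = 0"
  by (auto simp: ramp_def divide_simps)

lemma continuous_map_mdist_from:
  assumes "z \<in> mspace Z"
  shows "continuous_map (mtopology_of Z) euclideanreal (mdist Z z)"
proof (rule lipschitz_imp_continuous_map_real)
  fix x y assume "x \<in> mspace Z" "y \<in> mspace Z"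
  then show "mdist Z z x \<le> mdist Z z y + 1 * mdist Z x y"
    using mdist_triangle[of z Z y x] assms by (simp add: mdist_commute)
qed

lemma continuous_map_ramp:
  assumes "z \<in> mspace Z" "r < s"
  shows "continuous_map (mtopology_of Z) euclideanreal (ramp Z z r s)"
  unfolding ramp_def[abs_def] using assms
  by (intro continuous_map_real_max continuous_map_real_min continuous_map_real_divide
      continuous_map_diff continuous_map_mdist_from) auto

lemma fmeasurable_integrable_indicator:
  "S \<in> fmeasurable M \<Longrightarrow> integrable M (indicator S :: _ \<Rightarrow> real)"
  by (simp add: fmeasurable_def)

section \<open>Masses of balls under weak convergence in the common ambient space\<close>

locale embedded_pmm_sequence =
  fixes X :: "enat \<Rightarrow> 'a metric" and m :: "enat \<Rightarrow> 'a measure" and a :: "enat \<Rightarrow> 'a"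
    and Z :: "'z metric" and \<iota> :: "enat \<Rightarrow> 'a \<Rightarrow> 'z"
  assumes pmm: "pmm_space (X n) (m n) (a n)"
    and embedding: "isometric_embedding (X n) Z (\<iota> n)"
    and weak: "weakly_converges Z
          (\<lambda>n. distr (m (enat n)) (metric_borel Z) (\<iota> (enat n)))
          (distr (m \<infinity>) (metric_borel Z) (\<iota> \<infinity>))"
    and base_limit: "limitin (mtopology_of Z) (\<lambda>n. \<iota> (enat n) (a (enat n))) (\<iota> \<infinity> (a \<infinity>)) sequentially"
begin

abbreviation "d \<equiv> mdist Z"

abbreviation "z\<^sub>0 \<equiv> \<iota> \<infinity> (a \<infinity>)"

lemma sets_m: "sets (m n) = sets (metric_borel (X n))"
  using pmm by (auto simp: pmm_space_def)

lemma space_m [simp]: "space (m n) = mspace (X n)"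
  using sets_eq_imp_space_eq[OF sets_m] by simp

lemma a_in [simp]: "a n \<in> mspace (X n)"
  using pmm[of n] by (auto simp: pmm_space_def metric_support_def)

lemma \<iota>_in [simp]: "x \<in> mspace (X n) \<Longrightarrow> \<iota> n x \<in> mspace Z"
  using embedding[of n] by (auto simp: isometric_embedding_def)

lemma d_\<iota> [simp]: "\<lbrakk>x \<in> mspace (X n); y \<in> mspace (X n)\<rbrakk> \<Longrightarrow> d (\<iota> n x) (\<iota> n y) = mdist (X n) x y"
  using embedding[of n] by (auto simp: isometric_embedding_def)

lemma measurable_\<iota> [measurable]: "\<iota> n \<in> m n \<rightarrow>\<^sub>M metric_borel Z"
  using isometric_embedding_measurable[OF embedding] measurable_cong_sets[OF sets_m refl] by blast

lemma measurable_continuous_\<iota>: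
  fixes \<phi> :: "'z \<Rightarrow> real"
  assumes "continuous_map (mtopology_of Z) euclideanreal \<phi>"
  shows "(\<lambda>x. \<phi> (\<iota> n x)) \<in> borel_measurable (m n)"
  using measurable_compose[OF measurable_\<iota> continuous_map_imp_borel_measurable[OF assms]] .

lemma measurable_d_\<iota>: "z \<in> mspace Z \<Longrightarrow> (\<lambda>x. d z (\<iota> n x)) \<in> borel_measurable (m n)"
  by (rule measurable_continuous_\<iota>[OF continuous_map_mdist_from])

lemma sets_near:
  assumes "z \<in> mspace Z"
  shows "{x \<in> mspace (X n). d z (\<iota> n x) \<le> r} \<in> sets (m n)"
    and "{x \<in> mspace (X n). d z (\<iota> n x) < r} \<in> sets (m n)"
proof -
  note [measurable] = measurable_d_\<iota>[OF assms]
  have "{x \<in> space (m n). d z (\<iota> n x) \<le> r} \<in> sets (m n)"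
    "{x \<in> space (m n). d z (\<iota> n x) < r} \<in> sets (m n)" by measurable
  then show "{x \<in> mspace (X n). d z (\<iota> n x) \<le> r} \<in> sets (m n)"
    "{x \<in> mspace (X n). d z (\<iota> n x) < r} \<in> sets (m n)" by auto
qed

text \<open>The point \<open>z\<close> may lie off the image of \<open>X n\<close>, so the set need
  not be a ball of \<open>X n\<close>. The triangle inequality through \<open>z\<close>, taken in
  \<open>Z\<close>, still bounds its diameter by \<open>2 * r\<close>, and bounded sets have finite
  mass.\<close>

lemma finite_near:
  assumes "z \<in> mspace Z"
  shows "emeasure (m n) {x \<in> mspace (X n). d z (\<iota> n x) \<le> r} < \<infinity>" (is "emeasure _ ?S < _")
proof -
  interpret M: Metric_space "mspace (X n)" "mdist (X n)" by simp
  have "mdist (X n) x y \<le> 2 * r" if "x \<in> ?S" "y \<in> ?S" for x y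
    using mdist_triangle[of "\<iota> n x" Z z "\<iota> n y"] that assms by (simp add: mdist_commute)
  then have "bounded_in (X n) ?S"
    unfolding bounded_in_def M.mbounded_alt by fastforce
  then show ?thesis
    using pmm[of n] sets_near(1)[OF assms] by (auto simp: pmm_space_def)
qed

lemma fmeasurable_near:
  assumes "z \<in> mspace Z"
  shows "{x \<in> mspace (X n). d z (\<iota> n x) \<le> r} \<in> fmeasurable (m n)"
    and "{x \<in> mspace (X n). d z (\<iota> n x) < r} \<in> fmeasurable (m n)"
proof -
  show *: "{x \<in> mspace (X n). d z (\<iota> n x) \<le> r} \<in> fmeasurable (m n)"
    using finite_near sets_near assms by (simp add: fmeasurable_def)
  show "{x \<in> mspace (X n). d z (\<iota> n x) < r} \<in> fmeasurable (m n)"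
    using sets_near assms by (intro fmeasurableI2[OF *]) auto
qed

lemma mball_of_eq_near:
  "x \<in> mspace (X n) \<Longrightarrow> mball_of (X n) x r = {y \<in> mspace (X n). d (\<iota> n x) (\<iota> n y) < r}"
  by auto

lemma fmeasurable_mball: "mball_of (X n) x r \<in> fmeasurable (m n)"
proof (cases "x \<in> mspace (X n)")
  case True
  then show ?thesis using fmeasurable_near(2)[of "\<iota> n x" n r] mball_of_eq_near[of x n r] by simp
next
  case False
  then have "mball_of (X n) x r = {}" by auto
  then show ?thesis by simp
qed

lemma integrable_test:
  fixes \<phi> :: "'z \<Rightarrow> real"
  assumes "z \<in> mspace Z" "continuous_map (mtopology_of Z) euclideanreal \<phi>"
    and "\<And>w. w \<in> mspace Z \<Longrightarrow> \<bar>\<phi> w\<bar> \<le> M" "\<And>w. w \<in> mspace Z \<Longrightarrow> s < d z w \<Longrightarrow> \<phi> w = 0"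
  shows "integrable (m n) (\<lambda>x. \<phi> (\<iota> n x))"
proof (rule Bochner_Integration.integrable_bound)
  show "integrable (m n) (\<lambda>x. M * indicator {x \<in> mspace (X n). d z (\<iota> n x) \<le> s} x)"
    using fmeasurable_near(1)[OF assms(1), of n s] by (auto simp: fmeasurable_def)
  show "AE x in m n. norm (\<phi> (\<iota> n x)) \<le> norm (M * indicator {x \<in> mspace (X n). d z (\<iota> n x) \<le> s} x)"
  proof (intro AE_I2)
    fix x assume "x \<in> space (m n)"
    then show "norm (\<phi> (\<iota> n x)) \<le> norm (M * indicator {x \<in> mspace (X n). d z (\<iota> n x) \<le> s} x)"
      using assms(3,4)[of "\<iota> n x"] by (cases "d z (\<iota> n x) \<le> s") auto
  qed
qed (rule measurable_continuous_\<iota>[OF assms(2)])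

text \<open>A change of variables moves the image measures on \<open>Z\<close> back to the spaces
  \<open>X n\<close>. Weak convergence is used below only in this form.\<close>

lemma integral_test_tendsto:
  fixes \<phi> :: "'z \<Rightarrow> real"
  assumes "z \<in> mspace Z" "continuous_map (mtopology_of Z) euclideanreal \<phi>"
    and "\<And>w. w \<in> mspace Z \<Longrightarrow> \<bar>\<phi> w\<bar> \<le> M" "\<And>w. w \<in> mspace Z \<Longrightarrow> s < d z w \<Longrightarrow> \<phi> w = 0"
  shows "(\<lambda>n. \<integral>x. \<phi> (\<iota> (enat n) x) \<partial>m (enat n)) \<longlonglongrightarrow> (\<integral>x. \<phi> (\<iota> \<infinity> x) \<partial>m \<infinity>)"
proof -
  interpret M: Metric_space "mspace Z" d by simp
  have "{w \<in> mspace Z. \<phi> w \<noteq> 0} \<subseteq> M.mcball z s"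
    using assms by force
  then have "bounded_in Z {w \<in> mspace Z. \<phi> w \<noteq> 0}"
    unfolding bounded_in_def M.mbounded_def by blast
  moreover have "bounded (\<phi> ` mspace Z)"
    using assms(3) by (auto simp: bounded_iff)
  ultimately have "(\<lambda>n. integral\<^sup>L (distr (m (enat n)) (metric_borel Z) (\<iota> (enat n))) \<phi>)
      \<longlonglongrightarrow> integral\<^sup>L (distr (m \<infinity>) (metric_borel Z) (\<iota> \<infinity>)) \<phi>"
    using weak assms(2) unfolding weakly_converges_def by blast
  then show ?thesis
    by (simp only: integral_distr[OF measurable_\<iota> continuous_map_imp_borel_measurable[OF assms(2)]])
qed

text \<open>One half of the portmanteau theorem for balls: the cutoff lies between the indicators of
  the two concentric balls, and its integrals converge. Because of the gap between \<open>r\<close>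
  and \<open>s\<close>, spheres of positive mass do no harm.\<close>

lemma eventually_mass_le:
  assumes "z \<in> mspace Z" "r < s" "0 < e"
  shows "\<forall>\<^sub>F n in sequentially. measure (m (enat n)) {x \<in> mspace (X (enat n)). d z (\<iota> (enat n) x) \<le> r}
     \<le> measure (m \<infinity>) {x \<in> mspace (X \<infinity>). d z (\<iota> \<infinity> x) < s} + e"
proof -
  define \<phi> where "\<phi> = ramp Z z r s"
  have \<phi>: "continuous_map (mtopology_of Z) euclideanreal \<phi>" "\<And>w. \<bar>\<phi> w\<bar> \<le> 1"
    "\<And>w. s < d z w \<Longrightarrow> \<phi> w = 0"
    using continuous_map_ramp[of z Z r s] assms ramp_nonneg[of Z z r s] ramp_le_1[of Z z r s]
    by (simp_all add: \<phi>_def ramp_eq_0)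
  note I = integrable_test[OF assms(1) \<phi>]
  have "(\<integral>x. \<phi> (\<iota> \<infinity> x) \<partial>m \<infinity>) \<le> (\<integral>x. indicator {x \<in> mspace (X \<infinity>). d z (\<iota> \<infinity> x) < s} x \<partial>m \<infinity>)"
    by (intro integral_mono I fmeasurable_integrable_indicator fmeasurable_near assms)
      (auto simp: indicator_def \<phi>_def ramp_le_1 ramp_eq_0 assms)
  then have le: "(\<integral>x. \<phi> (\<iota> \<infinity> x) \<partial>m \<infinity>) \<le> measure (m \<infinity>) {x \<in> mspace (X \<infinity>). d z (\<iota> \<infinity> x) < s}"
    by (simp add: Int_def conj_commute)
  have "\<forall>\<^sub>F n in sequentially. (\<integral>x. \<phi> (\<iota> (enat n) x) \<partial>m (enat n)) < (\<integral>x. \<phi> (\<iota> \<infinity> x) \<partial>m \<infinity>) + e"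
    using integral_test_tendsto[OF assms(1) \<phi>] assms(3) by (intro order_tendstoD) auto
  then show ?thesis
  proof eventually_elim
    case (elim n)
    have "(\<integral>x. indicator {x \<in> mspace (X (enat n)). d z (\<iota> (enat n) x) \<le> r} x \<partial>m (enat n))
        \<le> (\<integral>x. \<phi> (\<iota> (enat n) x) \<partial>m (enat n))"
      by (intro integral_mono I fmeasurable_integrable_indicator fmeasurable_near assms)
        (auto simp: indicator_def \<phi>_def ramp_nonneg ramp_eq_1 assms)
    then show ?case using elim le by (simp add: Int_def conj_commute)
  qed
qed

text \<open>The other half: the same cutoff, with the roles of the sequence and the limit
  exchanged.\<close>

lemma eventually_mass_ge:
  assumes "z \<in> mspace Z" "r < s" "0 < e"
  shows "\<forall>\<^sub>F n in sequentially. measure (m \<infinity>) {x \<in> mspace (X \<infinity>). d z (\<iota> \<infinity> x) \<le> r} - e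
     \<le> measure (m (enat n)) {x \<in> mspace (X (enat n)). d z (\<iota> (enat n) x) < s}"
proof -
  define \<phi> where "\<phi> = ramp Z z r s"
  have \<phi>: "continuous_map (mtopology_of Z) euclideanreal \<phi>" "\<And>w. \<bar>\<phi> w\<bar> \<le> 1"
    "\<And>w. s < d z w \<Longrightarrow> \<phi> w = 0"
    using continuous_map_ramp[of z Z r s] assms ramp_nonneg[of Z z r s] ramp_le_1[of Z z r s]
    by (simp_all add: \<phi>_def ramp_eq_0)
  note I = integrable_test[OF assms(1) \<phi>]
  have "(\<integral>x. indicator {x \<in> mspace (X \<infinity>). d z (\<iota> \<infinity> x) \<le> r} x \<partial>m \<infinity>) \<le> (\<integral>x. \<phi> (\<iota> \<infinity> x) \<partial>m \<infinity>)"
    by (intro integral_mono I fmeasurable_integrable_indicator fmeasurable_near assms)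
      (auto simp: indicator_def \<phi>_def ramp_nonneg ramp_eq_1 assms)
  then have le: "measure (m \<infinity>) {x \<in> mspace (X \<infinity>). d z (\<iota> \<infinity> x) \<le> r} \<le> (\<integral>x. \<phi> (\<iota> \<infinity> x) \<partial>m \<infinity>)"
    by (simp add: Int_def conj_commute)
  have "\<forall>\<^sub>F n in sequentially. (\<integral>x. \<phi> (\<iota> \<infinity> x) \<partial>m \<infinity>) - e < (\<integral>x. \<phi> (\<iota> (enat n) x) \<partial>m (enat n))"
    using integral_test_tendsto[OF assms(1) \<phi>] assms(3) by (intro order_tendstoD) auto
  then show ?thesis
  proof eventually_elim
    case (elim n)
    have "(\<integral>x. \<phi> (\<iota> (enat n) x) \<partial>m (enat n))
        \<le> (\<integral>x. indicator {x \<in> mspace (X (enat n)). d z (\<iota> (enat n) x) < s} x \<partial>m (enat n))"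
      by (intro integral_mono I fmeasurable_integrable_indicator fmeasurable_near assms)
        (auto simp: indicator_def \<phi>_def ramp_le_1 ramp_eq_0 assms)
    then show ?case using elim le by (simp add: Int_def conj_commute)
  qed
qed

end

section \<open>Diagonal choice of tolerances, and Lipschitz minorants on the ambient space\<close>

lemma eventually_diagonal:
  fixes P :: "nat \<Rightarrow> real \<Rightarrow> bool"
  assumes "\<And>e. 0 < e \<Longrightarrow> \<forall>\<^sub>F n in sequentially. P n e"
  obtains \<delta> where "\<delta> \<longlonglongrightarrow> 0" "\<forall>\<^sub>F n in sequentially. P n (\<delta> n)"
proof -
  have "\<forall>k. \<exists>N. \<forall>n\<ge>N. P n (inverse (real (Suc k)))"
    using assms by (simp add: eventually_sequentially)
  then obtain N where N: "\<And>k n. N k \<le> n \<Longrightarrow> P n (inverse (real (Suc k)))" by metis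
  \<comment> \<open>The best tolerance whose threshold has been passed at \<open>n\<close>. The
    bound \<open>k \<le> n\<close> keeps the set finite and \<open>k = 0\<close> keeps it nonempty;
    as 0 may be the maximum before its own threshold is passed, \<open>P\<close> is claimed only
    from \<open>N 0\<close> on.\<close>
  define K where "K n = Max {k. k \<le> n \<and> (k = 0 \<or> N k \<le> n)}" for n
  have fin: "finite {k. k \<le> n \<and> (k = 0 \<or> N k \<le> n)}" for n by simp
  have K: "K n = 0 \<or> N (K n) \<le> n" for n
    using Max_in[OF fin, of n] by (auto simp: K_def)
  have K_ge: "k \<le> K n" if "max k (N k) \<le> n" for k n
    using that unfolding K_def by (intro Max_ge[OF fin]) auto
  have "P n (inverse (real (Suc (K n))))" if "N 0 \<le> n" for n
    using N[of "K n" n] K[of n] that by auto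
  moreover have "filterlim K at_top sequentially"
    unfolding filterlim_at_top by (metis (lifting) K_ge eventually_sequentiallyI)
  ultimately show thesis
    using filterlim_compose[OF LIMSEQ_inverse_real_of_nat]
    by (intro that[of "\<lambda>n. inverse (real (Suc (K n)))"] eventually_sequentiallyI[of "N 0"])
qed

context embedded_pmm_sequence
begin

text \<open>The Pasch-Hausdorff envelope of \<phi>, taken at all points of \<open>Z\<close>: for
  nonnegative \<open>k\<close> and \<phi> it is the largest \<open>k\<close>-Lipschitz function on
  \<open>Z\<close> that lies below \<phi> on the image of the limit space. For \<phi> = 0 and
  \<open>k = 1\<close> it is the distance to that image.\<close>

definition lip_minorant :: "real \<Rightarrow> ('a \<Rightarrow> real) \<Rightarrow> 'z \<Rightarrow> real" where
  "lip_minorant k \<phi> z = (INF y\<in>mspace (X \<infinity>). \<phi> y + k * d z (\<iota> \<infinity> y))"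

lemma lip_minorant_ge:
  assumes "\<And>y. y \<in> mspace (X \<infinity>) \<Longrightarrow> t \<le> \<phi> y + k * d z (\<iota> \<infinity> y)"
  shows "t \<le> lip_minorant k \<phi> z"
  unfolding lip_minorant_def by (rule cINF_greatest) (use a_in[of \<infinity>] assms in blast)+

text \<open>A real infimum is a lower bound only if the set is bounded below; nonnegativity of
  \<open>k\<close> and \<phi> supplies the bound 0.\<close>

lemma lip_minorant_le:
  assumes "0 \<le> k" "\<And>y. y \<in> mspace (X \<infinity>) \<Longrightarrow> 0 \<le> \<phi> y" "y \<in> mspace (X \<infinity>)"
  shows "lip_minorant k \<phi> z \<le> \<phi> y + k * d z (\<iota> \<infinity> y)"
  unfolding lip_minorant_def using assms
  by (intro cINF_lower bdd_belowI[of _ 0]) auto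

lemma lip_minorant_nonneg:
  assumes "0 \<le> k" "\<And>y. y \<in> mspace (X \<infinity>) \<Longrightarrow> 0 \<le> \<phi> y"
  shows "0 \<le> lip_minorant k \<phi> z"
  using assms by (intro lip_minorant_ge) auto

lemma continuous_map_lip_minorant:
  assumes "0 \<le> k" "\<And>y. y \<in> mspace (X \<infinity>) \<Longrightarrow> 0 \<le> \<phi> y"
  shows "continuous_map (mtopology_of Z) euclideanreal (lip_minorant k \<phi>)"
proof (rule lipschitz_imp_continuous_map_real)
  fix z w assume zw: "z \<in> mspace Z" "w \<in> mspace Z"
  have "lip_minorant k \<phi> z - k * d z w \<le> lip_minorant k \<phi> w"
  proof (rule lip_minorant_ge)
    fix y assume y: "y \<in> mspace (X \<infinity>)"
    have "k * d z (\<iota> \<infinity> y) \<le> k * (d z w + d w (\<iota> \<infinity> y))"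
      using mdist_triangle[of z Z w "\<iota> \<infinity> y"] zw y assms by (intro mult_left_mono) auto
    then show "lip_minorant k \<phi> z - k * d z w \<le> \<phi> y + k * d w (\<iota> \<infinity> y)"
      using lip_minorant_le[of k \<phi> y z, OF assms y] by (simp add: algebra_simps)
  qed
  then show "lip_minorant k \<phi> z \<le> lip_minorant k \<phi> w + k * d z w" by simp
qed

lemma eventually_base_near:
  assumes "0 < e"
  shows "\<forall>\<^sub>F n in sequentially. d z\<^sub>0 (\<iota> (enat n) (a (enat n))) < e"
proof -
  interpret M: Metric_space "mspace Z" d by simp
  show ?thesis
    using base_limit assms unfolding mtopology_of_def M.limitin_metric
    by (auto simp: mdist_commute elim: eventually_mono)
qed

end

section \<open>Consequences of doubling and of full support\<close>

locale doubling_pmm_sequence = embedded_pmm_sequence +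
  fixes c :: real
  assumes c_pos: "0 < c"
    and doubling: "doubling c (X n) (m n)"
    and full_support: "metric_support (X \<infinity>) (m \<infinity>) = mspace (X \<infinity>)"
begin

lemma mass_dilate_le:
  assumes "x \<in> mspace (X n)" "0 < r"
  shows "measure (m n) (mball_of (X n) x (2 ^ k * r)) \<le> c ^ k * measure (m n) (mball_of (X n) x r)"
proof (induction k)
  case (Suc k)
  have em: "emeasure (m n) (mball_of (X n) x t) = ennreal (measure (m n) (mball_of (X n) x t))" for t
    using fmeasurable_mball[of n x t] by (intro emeasure_eq_ennreal_measure) (auto simp: fmeasurable_def)
  have "emeasure (m n) (mball_of (X n) x (2 * (2 ^ k * r)))
      \<le> ennreal c * emeasure (m n) (mball_of (X n) x (2 ^ k * r))"
    using doubling[of n] assms by (simp add: doubling_def)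
  then have "measure (m n) (mball_of (X n) x (2 * (2 ^ k * r)))
      \<le> c * measure (m n) (mball_of (X n) x (2 ^ k * r))"
    using c_pos by (simp add: em ennreal_mult'[symmetric])
  also have "\<dots> \<le> c * (c ^ k * measure (m n) (mball_of (X n) x r))"
    using Suc c_pos by (intro mult_left_mono) auto
  finally show ?case by (simp add: mult.assoc)
qed simp

text \<open>Full support enters the proof through this positivity alone.\<close>

lemma mass_pos:
  assumes "y \<in> mspace (X \<infinity>)" "0 < r"
  shows "0 < measure (m \<infinity>) (mball_of (X \<infinity>) y r)"
proof -
  interpret M: Metric_space "mspace (X \<infinity>)" "mdist (X \<infinity>)" by simp
  have "openin (mtopology_of (X \<infinity>)) (mball_of (X \<infinity>) y r)"
    by (simp add: mtopology_of_def mball_of_def)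
  moreover have "y \<in> metric_support (X \<infinity>) (m \<infinity>)" "y \<in> mball_of (X \<infinity>) y r"
    using assms full_support by auto
  ultimately have "0 < emeasure (m \<infinity>) (mball_of (X \<infinity>) y r)"
    unfolding metric_support_def by blast
  then show ?thesis
    using fmeasurable_mball[of \<infinity> y r]
    by (simp add: fmeasurable_def measure_def enn2real_positive_iff)
qed

text \<open>A ball about \<open>y\<close> has positive limit mass, so its trace on
  \<open>X n\<close> is eventually charged by \<open>m n\<close> and hence nonempty.\<close>

lemma eventually_approximable:
  assumes "y \<in> mspace (X \<infinity>)" "0 < e"
  shows "\<forall>\<^sub>F n in sequentially. \<exists>x\<in>mspace (X (enat n)). d (\<iota> \<infinity> y) (\<iota> (enat n) x) < e"
proof -
  have v: "0 < measure (m \<infinity>) (mball_of (X \<infinity>) y (e / 2))" (is "0 < ?v") using assms mass_pos by simp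
  have "?v \<le> measure (m \<infinity>) {x \<in> mspace (X \<infinity>). d (\<iota> \<infinity> y) (\<iota> \<infinity> x) \<le> e / 2}"
    using assms fmeasurable_mball
    by (intro measure_mono_fmeasurable[OF _ _ fmeasurable_near(1)]) auto
  moreover have "\<forall>\<^sub>F n in sequentially. measure (m \<infinity>) {x \<in> mspace (X \<infinity>). d (\<iota> \<infinity> y) (\<iota> \<infinity> x) \<le> e / 2} - ?v / 2
     \<le> measure (m (enat n)) {x \<in> mspace (X (enat n)). d (\<iota> \<infinity> y) (\<iota> (enat n) x) < e}"
    using assms v by (intro eventually_mass_ge) auto
  ultimately have "\<forall>\<^sub>F n in sequentially.
      0 < measure (m (enat n)) {x \<in> mspace (X (enat n)). d (\<iota> \<infinity> y) (\<iota> (enat n) x) < e}"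
    using v by (auto elim!: eventually_mono)
  then show ?thesis
  proof eventually_elim
    case (elim n)
    then have "{x \<in> mspace (X (enat n)). d (\<iota> \<infinity> y) (\<iota> (enat n) x) < e} \<noteq> {}"
      by (metis less_irrefl measure_empty)
    then show ?case by auto
  qed
qed

lemma ex_power_two_ge: "0 < r \<Longrightarrow> \<exists>k. t \<le> 2 ^ k * (r::real)"
  by (metis less_eq_real_def one_less_numeral_iff pos_divide_less_eq real_arch_pow semiring_norm(76))

text \<open>By weak convergence the ball of radius 1/2 about \<open>z\<^sub>0\<close> keeps a fixed
  mass in \<open>X n\<close>. It lies in the ball of radius \<open>R + 1\<close> about each
  \<open>x\<close> in question, and passing from there down to radius \<open>r\<close> costs at most
  the factor \<open>c ^ k\<close>.\<close>

lemma eventually_ball_mass_ge: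
  assumes "0 < r"
  obtains v where "0 < v" "\<forall>\<^sub>F n in sequentially. \<forall>x\<in>mball_of (X (enat n)) (a (enat n)) R.
    v \<le> measure (m (enat n)) (mball_of (X (enat n)) x r)"
proof -
  obtain k where k: "R + 1 \<le> 2 ^ k * r" using ex_power_two_ge[OF assms] by blast
  \<comment> \<open>The radii 1/4 and 1/2 leave the gap that \<open>eventually_mass_ge\<close> asks
    for, and half of the limit mass is given up as its error.\<close>
  have v: "0 < measure (m \<infinity>) (mball_of (X \<infinity>) (a \<infinity>) (1 / 4))" (is "0 < ?v") using mass_pos by simp
  have "?v \<le> measure (m \<infinity>) {x \<in> mspace (X \<infinity>). d z\<^sub>0 (\<iota> \<infinity> x) \<le> 1 / 4}"
    using fmeasurable_mball
    by (intro measure_mono_fmeasurable[OF _ _ fmeasurable_near(1)]) auto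
  moreover have "\<forall>\<^sub>F n in sequentially. measure (m \<infinity>) {x \<in> mspace (X \<infinity>). d z\<^sub>0 (\<iota> \<infinity> x) \<le> 1 / 4} - ?v / 2
     \<le> measure (m (enat n)) {x \<in> mspace (X (enat n)). d z\<^sub>0 (\<iota> (enat n) x) < 1 / 2}"
    using v by (intro eventually_mass_ge) auto
  ultimately have "\<forall>\<^sub>F n in sequentially.
      ?v / 2 \<le> measure (m (enat n)) {x \<in> mspace (X (enat n)). d z\<^sub>0 (\<iota> (enat n) x) < 1 / 2}"
    by (auto elim!: eventually_mono)
  moreover have "\<forall>\<^sub>F n in sequentially. d z\<^sub>0 (\<iota> (enat n) (a (enat n))) < 1 / 2"
    by (rule eventually_base_near) simp
  ultimately have "\<forall>\<^sub>F n in sequentially. \<forall>x\<in>mball_of (X (enat n)) (a (enat n)) R.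
    ?v / 2 / c ^ k \<le> measure (m (enat n)) (mball_of (X (enat n)) x r)"
  proof eventually_elim
    case (elim n)
    show ?case
    proof
      fix x assume x: "x \<in> mball_of (X (enat n)) (a (enat n)) R"
      have "{y \<in> mspace (X (enat n)). d z\<^sub>0 (\<iota> (enat n) y) < 1 / 2} \<subseteq> mball_of (X (enat n)) x (2 ^ k * r)"
      proof
        fix y assume y: "y \<in> {y \<in> mspace (X (enat n)). d z\<^sub>0 (\<iota> (enat n) y) < 1 / 2}"
        have "mdist (X (enat n)) (a (enat n)) y < 1"
          using mdist_triangle[of "\<iota> (enat n) (a (enat n))" Z z\<^sub>0 "\<iota> (enat n) y"] y elim
          by (simp add: mdist_commute)
        then show "y \<in> mball_of (X (enat n)) x (2 ^ k * r)"
          using mdist_triangle[of x "X (enat n)" "a (enat n)" y] x y k by (simp add: mdist_commute)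
      qed
      then have "?v / 2 \<le> measure (m (enat n)) (mball_of (X (enat n)) x (2 ^ k * r))"
        using elim(1) sets_near(2)[of z\<^sub>0 "enat n" "1 / 2"]
        by (intro order_trans[OF elim(1)] measure_mono_fmeasurable fmeasurable_mball) simp_all
      also have "\<dots> \<le> c ^ k * measure (m (enat n)) (mball_of (X (enat n)) x r)"
        using x assms by (intro mass_dilate_le) auto
      finally show "?v / 2 / c ^ k \<le> measure (m (enat n)) (mball_of (X (enat n)) x r)"
        using c_pos by (simp add: field_simps)
    qed
  qed
  then show thesis using v c_pos by (intro that[of "?v / 2 / c ^ k"]) auto
qed

text \<open>The test function \<open>\<phi>\<close> vanishes on the image of the limit space, whereas a point of \<open>X\<^sub>n\<close>
  far from that image would, by the uniform lower mass bound, keep its integral away from zero.\<close>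

lemma eventually_ball_near_limit:
  assumes "0 < e"
  shows "\<forall>\<^sub>F n in sequentially. \<forall>x\<in>mball_of (X (enat n)) (a (enat n)) R.
     \<exists>y\<in>mspace (X \<infinity>). d (\<iota> (enat n) x) (\<iota> \<infinity> y) < e"
proof -
  obtain v where v: "0 < v" "\<forall>\<^sub>F n in sequentially. \<forall>x\<in>mball_of (X (enat n)) (a (enat n)) R.
    v \<le> measure (m (enat n)) (mball_of (X (enat n)) x (e / 2))"
    using eventually_ball_mass_ge[of "e / 2" R] assms by auto
  \<comment> \<open>Once the base points are within 1 of \<open>z\<^sub>0\<close>, the
    \<open>e / 2\<close>-balls about the points of the \<open>R\<close>-ball stay within
    \<open>r\<close> of \<open>z\<^sub>0\<close>, where the cutoff equals 1.\<close>
  define r where "r = R + e + 1"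
  \<comment> \<open>\<open>D\<close> is the distance to the image of the limit space; the minimum
    with \<open>e\<close> below makes the test function bounded.\<close>
  define D where "D = lip_minorant 1 (\<lambda>_. 0)"
  define \<phi> where "\<phi> w = min e (D w) * ramp Z z\<^sub>0 r (r + 1) w" for w
  have D: "0 \<le> D w" for w unfolding D_def by (rule lip_minorant_nonneg) auto
  have cont: "continuous_map (mtopology_of Z) euclideanreal \<phi>"
    unfolding \<phi>_def[abs_def] D_def
    by (intro continuous_map_real_mult continuous_map_real_min continuous_map_lip_minorant
        continuous_map_ramp) auto
  have nonneg: "0 \<le> \<phi> w" for w using D[of w] assms by (simp add: \<phi>_def ramp_nonneg)
  have bd: "\<bar>\<phi> w\<bar> \<le> e" for w
    using D[of w] assms ramp_nonneg[of Z z\<^sub>0 r "r + 1" w] ramp_le_1[of Z z\<^sub>0 r "r + 1" w]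
      mult_mono[of "min e (D w)" e "ramp Z z\<^sub>0 r (r + 1) w" 1]
    by (simp add: \<phi>_def abs_mult)
  have supp: "\<phi> w = 0" if "r + 1 < d z\<^sub>0 w" for w
    using that by (simp add: \<phi>_def ramp_eq_0)
  note test = cont bd supp
  have "\<phi> (\<iota> \<infinity> x) = 0" if "x \<in> mspace (X \<infinity>)" for x
  proof -
    have "D (\<iota> \<infinity> x) \<le> d (\<iota> \<infinity> x) (\<iota> \<infinity> x)"
      using lip_minorant_le[of 1 "\<lambda>_. 0" x "\<iota> \<infinity> x"] that by (simp add: D_def)
    then have "D (\<iota> \<infinity> x) = 0" using D[of "\<iota> \<infinity> x"] that by simp
    then show ?thesis using assms by (simp add: \<phi>_def)
  qed
  then have "(\<integral>x. \<phi> (\<iota> \<infinity> x) \<partial>m \<infinity>) = (\<integral>x. 0 \<partial>m \<infinity>)"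
    by (intro Bochner_Integration.integral_cong) auto
  then have "(\<lambda>n. \<integral>x. \<phi> (\<iota> (enat n) x) \<partial>m (enat n)) \<longlonglongrightarrow> 0"
    using integral_test_tendsto[of z\<^sub>0, OF _ test] by simp
  then have "\<forall>\<^sub>F n in sequentially. (\<integral>x. \<phi> (\<iota> (enat n) x) \<partial>m (enat n)) < e / 2 * v"
    using v assms by (intro order_tendstoD) auto
  moreover have "\<forall>\<^sub>F n in sequentially. d z\<^sub>0 (\<iota> (enat n) (a (enat n))) < 1"
    by (rule eventually_base_near) simp
  ultimately show ?thesis using v(2)
  proof eventually_elim
    case (elim n)
    show ?case
    proof (rule ballI, rule ccontr)
      fix x assume x: "x \<in> mball_of (X (enat n)) (a (enat n)) R"
        and "\<not> (\<exists>y\<in>mspace (X \<infinity>). d (\<iota> (enat n) x) (\<iota> \<infinity> y) < e)"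
      then have far: "e \<le> d (\<iota> (enat n) x) (\<iota> \<infinity> y)" if "y \<in> mspace (X \<infinity>)" for y
        using that by force
      \<comment> \<open>The whole \<open>e / 2\<close>-ball about \<open>x\<close> stays at distance
        at least \<open>e / 2\<close> from the image, so the integral is at least
        \<open>e / 2 * v\<close>.\<close>
      have ge: "e / 2 \<le> \<phi> (\<iota> (enat n) w)" if w: "w \<in> mball_of (X (enat n)) x (e / 2)" for w
      proof -
        have "e / 2 \<le> D (\<iota> (enat n) w)"
          unfolding D_def
        proof (rule lip_minorant_ge)
          fix y assume y: "y \<in> mspace (X \<infinity>)"
          show "e / 2 \<le> 0 + 1 * d (\<iota> (enat n) w) (\<iota> \<infinity> y)"
            using far[OF y] mdist_triangle[of "\<iota> (enat n) x" Z "\<iota> (enat n) w" "\<iota> \<infinity> y"] w y by simp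
        qed
        moreover have "d z\<^sub>0 (\<iota> (enat n) w) \<le> r"
          using elim(2) x w mdist_triangle[of z\<^sub>0 Z "\<iota> (enat n) (a (enat n))" "\<iota> (enat n) w"]
            mdist_triangle[of "a (enat n)" "X (enat n)" x w] assms
          by (simp add: r_def)
        ultimately show ?thesis using assms by (simp add: \<phi>_def ramp_eq_1)
      qed
      have "e / 2 * v \<le> e / 2 * measure (m (enat n)) (mball_of (X (enat n)) x (e / 2))"
        using elim(3) x assms by (intro mult_left_mono) auto
      also have "\<dots> = (\<integral>w. e / 2 * indicator (mball_of (X (enat n)) x (e / 2)) w \<partial>m (enat n))"
      proof -
        have "mball_of (X (enat n)) x (e / 2) \<inter> mspace (X (enat n)) = mball_of (X (enat n)) x (e / 2)"
          by auto
        then show ?thesis by simp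
      qed
      also have "\<dots> \<le> (\<integral>w. \<phi> (\<iota> (enat n) w) \<partial>m (enat n))"
      proof (intro integral_mono integrable_mult_right fmeasurable_integrable_indicator fmeasurable_mball)
        show "integrable (m (enat n)) (\<lambda>w. \<phi> (\<iota> (enat n) w))"
          by (rule integrable_test[of z\<^sub>0, OF _ test]) auto
        fix w show "e / 2 * indicator (mball_of (X (enat n)) x (e / 2)) w \<le> \<phi> (\<iota> (enat n) w)"
          by (cases "w \<in> mball_of (X (enat n)) x (e / 2)") (use ge nonneg in auto)
      qed
      finally show False using elim(1) by simp
    qed
  qed
qed

text \<open>A separated set of greatest cardinality is a net. A packing argument bounds the
  cardinalities: the \<open>e / 2\<close>-balls about the points are disjoint, each has mass at
  least \<open>v\<close>, and all lie in one ball of mass \<open>V\<close>.\<close>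

lemma limit_ball_finite_net:
  assumes "0 < e"
  obtains S where "finite S" "S \<subseteq> mball_of (X \<infinity>) (a \<infinity>) R"
    "\<And>y. y \<in> mball_of (X \<infinity>) (a \<infinity>) R \<Longrightarrow> \<exists>s\<in>S. mdist (X \<infinity>) s y < e"
proof (cases "0 < R")
  \<comment> \<open>The covering condition asks for a net at radius \<open>R - e\<close>, which may
    be nonpositive.\<close>
  case False
  then have "\<not> mdist (X \<infinity>) (a \<infinity>) y < R" for y
    using mdist_nonneg[of "X \<infinity>" "a \<infinity>" y] by linarith
  then have "mball_of (X \<infinity>) (a \<infinity>) R = {}" by auto
  then show thesis using that[of "{}"] by simp
next
  case True
  let ?A = "mball_of (X \<infinity>) (a \<infinity>) R" and ?B = "\<lambda>s. mball_of (X \<infinity>) s (e / 2)"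
  \<comment> \<open>Points of the ball are less than \<open>2 * R\<close> apart, so \<open>k\<close>
    doublings of an \<open>e / 2\<close>-ball about any of them swallow the whole ball.\<close>
  obtain k where k: "2 * R \<le> 2 ^ k * (e / 2)" using ex_power_two_ge[OF half_gt_zero[OF assms]] by blast
  define v where "v = measure (m \<infinity>) ?A / c ^ k"
  define V where "V = measure (m \<infinity>) (mball_of (X \<infinity>) (a \<infinity>) (R + e))"
  have v: "0 < v" using mass_pos[of "a \<infinity>" R] True c_pos by (simp add: v_def)
  have mass: "v \<le> measure (m \<infinity>) (?B s)" if s: "s \<in> ?A" for s
  proof -
    have "?A \<subseteq> mball_of (X \<infinity>) s (2 ^ k * (e / 2))"
    proof
      fix y assume "y \<in> ?A"
      then show "y \<in> mball_of (X \<infinity>) s (2 ^ k * (e / 2))"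
        using mdist_triangle[of s "X \<infinity>" "a \<infinity>" y] s k by (simp add: mdist_commute)
    qed
    then have "measure (m \<infinity>) ?A \<le> measure (m \<infinity>) (mball_of (X \<infinity>) s (2 ^ k * (e / 2)))"
      using fmeasurable_mball by (intro measure_mono_fmeasurable) auto
    also have "\<dots> \<le> c ^ k * measure (m \<infinity>) (?B s)"
      using s assms by (intro mass_dilate_le) auto
    finally show ?thesis using c_pos by (simp add: v_def field_simps)
  qed
  define sep where "sep S \<longleftrightarrow> finite S \<and> S \<subseteq> ?A \<and> (\<forall>s\<in>S. \<forall>t\<in>S. s \<noteq> t \<longrightarrow> e \<le> mdist (X \<infinity>) s t)" for S
  have card: "card S \<le> nat \<lceil>V / v\<rceil>" if "sep S" for S
  proof -
    have S: "finite S" "S \<subseteq> ?A" "\<And>s t. s \<in> S \<Longrightarrow> t \<in> S \<Longrightarrow> s \<noteq> t \<Longrightarrow> e \<le> mdist (X \<infinity>) s t"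
      using that by (auto simp: sep_def)
    have disj: "disjoint_family_on ?B S"
      unfolding disjoint_family_on_def
    proof (intro ballI impI equals0I)
      fix s t y assume st: "s \<in> S" "t \<in> S" "s \<noteq> t" and y: "y \<in> ?B s \<inter> ?B t"
      then show False
        using S(3)[OF st] mdist_triangle[of s "X \<infinity>" y t] by (simp add: mdist_commute)
    qed
    have "card S * v \<le> (\<Sum>s\<in>S. measure (m \<infinity>) (?B s))"
      using mass S(2) by (intro sum_bounded_below) auto
    also have "\<dots> = measure (m \<infinity>) (\<Union>s\<in>S. ?B s)"
      using S(1) disj fmeasurable_mball
      by (intro measure_finite_Union[symmetric]) (auto simp: fmeasurable_def less_top)
    also have "\<dots> \<le> V"
      unfolding V_def
    proof (intro measure_mono_fmeasurable fmeasurable_mball)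
      show "(\<Union>s\<in>S. ?B s) \<subseteq> mball_of (X \<infinity>) (a \<infinity>) (R + e)"
      proof
        fix y assume "y \<in> (\<Union>s\<in>S. ?B s)"
        then obtain s where "s \<in> S" "y \<in> ?B s" by blast
        then show "y \<in> mball_of (X \<infinity>) (a \<infinity>) (R + e)"
          using mdist_triangle[of "a \<infinity>" "X \<infinity>" s y] S(2) assms by auto
      qed
      show "(\<Union>s\<in>S. ?B s) \<in> sets (m \<infinity>)"
        using S(1) fmeasurable_mball by (intro sets.finite_UN) auto
    qed
    finally have "card S \<le> V / v" using v by (simp add: field_simps)
    then show ?thesis by linarith
  qed
  have "sep {}" by (simp add: sep_def)
  then obtain S where S: "sep S" "\<And>T. sep T \<Longrightarrow> card T \<le> card S"
    using ex_has_greatest_nat[of sep "{}" card "Suc (nat \<lceil>V / v\<rceil>)"] card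
    by (metis le_imp_less_Suc)
  have "\<exists>s\<in>S. mdist (X \<infinity>) s y < e" if y: "y \<in> ?A" for y
  proof (rule ccontr)
    assume "\<not> (\<exists>s\<in>S. mdist (X \<infinity>) s y < e)"
    then have far: "e \<le> mdist (X \<infinity>) s y" if "s \<in> S" for s
      using that by force
    then have "sep (insert y S)"
      using S(1) y by (auto simp: sep_def mdist_commute)
    moreover have "y \<notin> S" using far[of y] assms y by auto
    moreover have "finite S" using S(1) by (simp add: sep_def)
    ultimately show False using S(2)[of "insert y S"] by simp
  qed
  then show thesis using S(1) that by (auto simp: sep_def)
qed

section \<open>Borel maps into the limit space with small displacement\<close>

lemma ex_borel_approximation:
  obtains g \<delta> where "\<And>n. g n \<in> metric_borel (X (enat n)) \<rightarrow>\<^sub>M metric_borel (X \<infinity>)"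
    "\<And>n. g n (a (enat n)) = a \<infinity>" "\<delta> \<longlonglongrightarrow> 0"
    "\<forall>\<^sub>F n in sequentially. \<forall>x\<in>mball_of (X (enat n)) (a (enat n)) R.
       d (\<iota> (enat n) x) (\<iota> \<infinity> (g n x)) < \<delta> n"
proof -
  interpret M: Metric_space "mspace (X \<infinity>)" "mdist (X \<infinity>)" by simp
  have "separable_space M.mtopology"
    using pmm[of \<infinity>] by (auto simp: pmm_space_def complete_separable_def mtopology_of_def)
  then obtain D where D: "countable D" "D \<subseteq> mspace (X \<infinity>)" "M.mtopology closure_of D = mspace (X \<infinity>)"
    by (auto simp: separable_space_def)
  have dense: "\<exists>y\<in>D. mdist (X \<infinity>) x y < r" if "x \<in> mspace (X \<infinity>)" "0 < r" for x r
  proof -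
    have "x \<in> M.mtopology closure_of D" using D(3) that by simp
    then show ?thesis using that by (auto simp: M.metric_closure_of)
  qed
  have "D \<noteq> {}" using dense[of "a \<infinity>" 1] by auto
  define y where "y = from_nat_into D"
  have range_y: "range y = D" using D(1) \<open>D \<noteq> {}\<close> by (simp add: y_def)
  then have y_in: "y k \<in> mspace (X \<infinity>)" for k using D(2) by auto
  \<comment> \<open>The first conjunct serves the base point, which is sent to
    \<open>a \<infinity>\<close> and not to a nearby \<open>y k\<close>.\<close>
  define P where "P n e \<longleftrightarrow> d z\<^sub>0 (\<iota> (enat n) (a (enat n))) < e \<and>
     (\<forall>x\<in>mball_of (X (enat n)) (a (enat n)) R. \<exists>k. d (\<iota> (enat n) x) (\<iota> \<infinity> (y k)) < e)" for n e
  have "\<forall>\<^sub>F n in sequentially. P n e" if "0 < e" for e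
    using eventually_base_near[OF that] eventually_ball_near_limit[OF half_gt_zero[OF that], of R]
  proof eventually_elim
    case (elim n)
    have "\<exists>k. d (\<iota> (enat n) x) (\<iota> \<infinity> (y k)) < e" if x: "x \<in> mball_of (X (enat n)) (a (enat n)) R" for x
    proof -
      obtain w where w: "w \<in> mspace (X \<infinity>)" "d (\<iota> (enat n) x) (\<iota> \<infinity> w) < e / 2" using elim x by blast
      then obtain k where "mdist (X \<infinity>) w (y k) < e / 2"
        using dense[OF w(1) half_gt_zero[OF \<open>0 < e\<close>]] range_y by auto
      then have "d (\<iota> (enat n) x) (\<iota> \<infinity> (y k)) < e"
        using w x y_in[of k] mdist_triangle[of "\<iota> (enat n) x" Z "\<iota> \<infinity> w" "\<iota> \<infinity> (y k)"] by simp
      then show ?thesis ..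
    qed
    then show ?case using elim by (simp add: P_def)
  qed
  then obtain \<delta> where \<delta>: "\<delta> \<longlonglongrightarrow> 0" "\<forall>\<^sub>F n in sequentially. P n (\<delta> n)"
    by (rule eventually_diagonal)
  \<comment> \<open>Where no index qualifies, as may happen outside the ball, \<open>LEAST\<close>
    still denotes some index, so \<open>g n\<close> maps all of \<open>X (enat n)\<close> into the
    limit space. It is Borel because the condition for each single \<open>k\<close> cuts out a Borel
    set, and so does the exceptional point.\<close>
  define g where "g n x = (if x \<in> {a (enat n)} then a \<infinity>
     else y (LEAST k. d (\<iota> (enat n) x) (\<iota> \<infinity> (y k)) < \<delta> n))" for n x
  show thesis
  proof (rule that[of g \<delta>])
    show "g n (a (enat n)) = a \<infinity>" for n by (simp add: g_def)
    show "\<forall>\<^sub>F n in sequentially. \<forall>x\<in>mball_of (X (enat n)) (a (enat n)) R.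
       d (\<iota> (enat n) x) (\<iota> \<infinity> (g n x)) < \<delta> n"
      using \<delta>(2)
    proof eventually_elim
      case (elim n)
      show ?case
      proof
        fix x assume "x \<in> mball_of (X (enat n)) (a (enat n)) R"
        then have "\<exists>k. d (\<iota> (enat n) x) (\<iota> \<infinity> (y k)) < \<delta> n" using elim by (simp add: P_def)
        from LeastI_ex[OF this] show "d (\<iota> (enat n) x) (\<iota> \<infinity> (g n x)) < \<delta> n"
          using elim by (auto simp: g_def P_def mdist_commute)
      qed
    qed
    fix n
    interpret N: Metric_space "mspace (X (enat n))" "mdist (X (enat n))" by simp
    have "Measurable.pred (m (enat n)) (\<lambda>x. d (\<iota> (enat n) x) (\<iota> \<infinity> (y k)) < \<delta> n)" for k
      using sets_near(2)[of "\<iota> \<infinity> (y k)" "enat n" "\<delta> n"] y_in[of k]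
      by (auto simp: pred_def mdist_commute)
    then have [measurable]: "(\<lambda>x. LEAST k. d (\<iota> (enat n) x) (\<iota> \<infinity> (y k)) < \<delta> n)
        \<in> m (enat n) \<rightarrow>\<^sub>M count_space UNIV"
      by (rule measurable_Least)
    have [measurable]: "y \<in> count_space UNIV \<rightarrow>\<^sub>M metric_borel (X \<infinity>)"
      using y_in by auto
    have "closedin (mtopology_of (X (enat n))) {a (enat n)}"
      unfolding mtopology_of_def by (intro closedin_t1_singleton N.t1_space_mtopology) simp
    then have [measurable]: "{a (enat n)} \<in> sets (m (enat n))"
      by (simp add: closedin_imp_sets_metric_borel sets_m)
    have [measurable]: "a \<infinity> \<in> space (metric_borel (X \<infinity>))" by simp
    have "g n \<in> m (enat n) \<rightarrow>\<^sub>M metric_borel (X \<infinity>)"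
      unfolding g_def by measurable
    then show "g n \<in> metric_borel (X (enat n)) \<rightarrow>\<^sub>M metric_borel (X \<infinity>)"
      using measurable_cong_sets[OF sets_m refl] by blast
  qed (rule \<delta>)
qed

end

section \<open>Masses and integrals over balls about the base points\<close>

context embedded_pmm_sequence
begin

text \<open>For nonnegative \<open>\<phi>\<close> the minorants increase to \<open>\<phi>\<close> on the limit space, but they live on the
  whole ambient space; so no extension theorem is needed to test the convergence in \<open>Z\<close>.\<close>

lemma lip_minorant_tendsto:
  assumes cont: "continuous_map (mtopology_of (X \<infinity>)) euclideanreal \<phi>"
    and nonneg: "\<And>y. y \<in> mspace (X \<infinity>) \<Longrightarrow> 0 \<le> \<phi> y" and x: "x \<in> mspace (X \<infinity>)"
  shows "(\<lambda>k. lip_minorant (real k) \<phi> (\<iota> \<infinity> x)) \<longlonglongrightarrow> \<phi> x"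
proof (rule order_tendstoI)
  have le: "lip_minorant (real k) \<phi> (\<iota> \<infinity> x) \<le> \<phi> x" for k
    using lip_minorant_le[of "real k" \<phi> x "\<iota> \<infinity> x"] nonneg x by simp
  show "\<forall>\<^sub>F k in sequentially. lip_minorant (real k) \<phi> (\<iota> \<infinity> x) < t" if "\<phi> x < t" for t
    using le that by (intro always_eventually allI) (rule order.strict_trans1)
  fix t assume "t < \<phi> x"
  then obtain u where u: "t < u" "u < \<phi> x" using dense by blast
  interpret M: Metric_space "mspace (X \<infinity>)" "mdist (X \<infinity>)" by simp
  have "openin (mtopology_of (X \<infinity>)) {y \<in> mspace (X \<infinity>). \<phi> y \<in> {u<..}}"
    using openin_continuous_map_preimage[OF cont, of "{u<..}"] by simp
  then obtain r where r: "0 < r" "M.mball x r \<subseteq> {y \<in> mspace (X \<infinity>). \<phi> y \<in> {u<..}}"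
    using x u unfolding mtopology_of_def M.openin_mtopology by blast
  \<comment> \<open>Within distance \<open>r\<close> of \<open>x\<close> already \<phi> exceeds
    \<open>u\<close>; farther away the penalty alone reaches \<open>\<phi> x\<close> once
    \<open>k\<close> is at least \<open>\<phi> x / r\<close>.\<close>
  obtain K :: nat where K: "\<phi> x / r \<le> real K" using real_arch_simple by blast
  have "u \<le> lip_minorant (real k) \<phi> (\<iota> \<infinity> x)" if k: "K \<le> k" for k
  proof (rule lip_minorant_ge)
    fix y assume y: "y \<in> mspace (X \<infinity>)"
    show "u \<le> \<phi> y + real k * d (\<iota> \<infinity> x) (\<iota> \<infinity> y)"
    proof (cases "mdist (X \<infinity>) x y < r")
      case True
      then have "y \<in> M.mball x r" using x y by simp
      then have "u < \<phi> y" using r(2) by blast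
      then show ?thesis by (simp add: add_increasing2)
    next
      case False
      have "\<phi> x \<le> real K * r" using K r by (simp add: field_simps)
      also have "\<dots> \<le> real k * mdist (X \<infinity>) x y" using False k r by (intro mult_mono) auto
      finally show ?thesis using nonneg[OF y] u x y by simp
    qed
  qed
  then show "\<forall>\<^sub>F k in sequentially. t < lip_minorant (real k) \<phi> (\<iota> \<infinity> x)"
    using u(1) by (intro eventually_sequentiallyI[of K]) (rule order.strict_trans2)
qed

text \<open>Separate indices for source and target cover both the approximating maps and the
  identity of the limit space.\<close>

lemma integrable_on_ball:
  fixes \<phi> :: "'a \<Rightarrow> real"
  assumes \<phi>: "\<phi> \<in> borel_measurable (metric_borel (X k))" "\<And>y. y \<in> mspace (X k) \<Longrightarrow> \<bar>\<phi> y\<bar> \<le> M"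
    and g: "g \<in> m n \<rightarrow>\<^sub>M metric_borel (X k)"
  shows "integrable (m n) (\<lambda>x. indicator (mball_of (X n) y R) x * \<phi> (g x))"
proof (rule Bochner_Integration.integrable_bound)
  note [measurable] = \<phi>(1) g fmeasurableD[OF fmeasurable_mball[of n y R]]
  show "(\<lambda>x. indicator (mball_of (X n) y R) x * \<phi> (g x)) \<in> borel_measurable (m n)"
    by measurable
  show "integrable (m n) (\<lambda>x. M * indicator (mball_of (X n) y R) x)"
    by (intro integrable_mult_right fmeasurable_integrable_indicator fmeasurable_mball)
  show "AE x in m n. norm (indicator (mball_of (X n) y R) x * \<phi> (g x))
      \<le> norm (M * indicator (mball_of (X n) y R) x)"
  proof (intro AE_I2)
    fix x assume "x \<in> space (m n)"
    then have "\<bar>\<phi> (g x)\<bar> \<le> M" using measurable_space[OF g] \<phi>(2) by simp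
    then show "norm (indicator (mball_of (X n) y R) x * \<phi> (g x))
      \<le> norm (M * indicator (mball_of (X n) y R) x)"
      by (auto simp: indicator_def)
  qed
qed

text \<open>Test functions are centred at the fixed point \<open>z\<^sub>0\<close>, the balls of
  \<open>X n\<close> at the moving base points. This inclusion and the next one exchange the centres
  at an arbitrarily small cost in radius.\<close>

lemma eventually_ball_subset_near:
  assumes "R < r"
  shows "\<forall>\<^sub>F n in sequentially. mball_of (X (enat n)) (a (enat n)) R
    \<subseteq> {x \<in> mspace (X (enat n)). d z\<^sub>0 (\<iota> (enat n) x) \<le> r}"
  using eventually_base_near[OF diff_gt_0_iff_gt[THEN iffD2, OF assms]]
proof eventually_elim
  case (elim n)
  show ?case
  proof
    fix x assume "x \<in> mball_of (X (enat n)) (a (enat n)) R"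
    then show "x \<in> {x \<in> mspace (X (enat n)). d z\<^sub>0 (\<iota> (enat n) x) \<le> r}"
      using elim mdist_triangle[of z\<^sub>0 Z "\<iota> (enat n) (a (enat n))" "\<iota> (enat n) x"] by simp
  qed
qed

lemma eventually_near_subset_ball:
  assumes "r < R"
  shows "\<forall>\<^sub>F n in sequentially. {x \<in> mspace (X (enat n)). d z\<^sub>0 (\<iota> (enat n) x) \<le> r}
    \<subseteq> mball_of (X (enat n)) (a (enat n)) R"
  using eventually_base_near[OF diff_gt_0_iff_gt[THEN iffD2, OF assms]]
proof eventually_elim
  case (elim n)
  show ?case
  proof
    fix x assume "x \<in> {x \<in> mspace (X (enat n)). d z\<^sub>0 (\<iota> (enat n) x) \<le> r}"
    then show "x \<in> mball_of (X (enat n)) (a (enat n)) R"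
      using elim mdist_triangle[of "\<iota> (enat n) (a (enat n))" Z z\<^sub>0 "\<iota> (enat n) x"]
      by (simp add: mdist_commute)
  qed
qed

lemma eventually_ball_mass_le:
  assumes "R < r" "0 < e"
  shows "\<forall>\<^sub>F n in sequentially. measure (m (enat n)) (mball_of (X (enat n)) (a (enat n)) R)
     \<le> measure (m \<infinity>) (mball_of (X \<infinity>) (a \<infinity>) r) + e"
proof -
  \<comment> \<open>The gap is split: from \<open>R\<close> to \<open>t\<close> for the motion of
    the base points, from \<open>t\<close> to \<open>r\<close> for the portmanteau
    inequality.\<close>
  define t where "t = (R + r) / 2"
  have t: "R < t" "t < r" using assms by (auto simp: t_def)
  have eq: "{x \<in> mspace (X \<infinity>). d z\<^sub>0 (\<iota> \<infinity> x) < r} = mball_of (X \<infinity>) (a \<infinity>) r"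
    using mball_of_eq_near[of "a \<infinity>" \<infinity> r] by simp
  have "\<forall>\<^sub>F n in sequentially. measure (m (enat n)) {x \<in> mspace (X (enat n)). d z\<^sub>0 (\<iota> (enat n) x) \<le> t}
     \<le> measure (m \<infinity>) (mball_of (X \<infinity>) (a \<infinity>) r) + e"
    using eventually_mass_le[of z\<^sub>0 t r e] t assms by (simp only: eq) simp
  then show ?thesis using eventually_ball_subset_near[OF t(1)]
  proof eventually_elim
    case (elim n)
    have "measure (m (enat n)) (mball_of (X (enat n)) (a (enat n)) R)
        \<le> measure (m (enat n)) {x \<in> mspace (X (enat n)). d z\<^sub>0 (\<iota> (enat n) x) \<le> t}"
      by (rule measure_mono_fmeasurable[OF elim(2) fmeasurableD[OF fmeasurable_mball] fmeasurable_near(1)])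
        simp
    then show ?case using elim by simp
  qed
qed

text \<open>Continuity of the limit mass at \<open>R\<close> closes the gap between the radii in the
  preceding lemma.\<close>

lemma eventually_ball_mass_le_isCont:
  assumes "isCont (\<lambda>R. measure (m \<infinity>) (mball_of (X \<infinity>) (a \<infinity>) R)) R" "0 < e"
  shows "\<forall>\<^sub>F n in sequentially. measure (m (enat n)) (mball_of (X (enat n)) (a (enat n)) R)
     \<le> measure (m \<infinity>) (mball_of (X \<infinity>) (a \<infinity>) R) + e"
proof -
  let ?h = "\<lambda>R. measure (m \<infinity>) (mball_of (X \<infinity>) (a \<infinity>) R)"
  obtain s where s: "0 < s" "\<And>r. dist r R < s \<Longrightarrow> dist (?h r) (?h R) < e / 2"
    using assms half_gt_zero[OF assms(2)] unfolding continuous_at_eps_delta by metis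
  have "dist (?h (R + s / 2)) (?h R) < e / 2"
    using s(1) by (intro s(2)) (simp add: dist_real_def)
  then have "?h (R + s / 2) < ?h R + e / 2"
    unfolding dist_real_def by linarith
  moreover have "\<forall>\<^sub>F n in sequentially. measure (m (enat n)) (mball_of (X (enat n)) (a (enat n)) R)
     \<le> ?h (R + s / 2) + e / 2"
    using s assms by (intro eventually_ball_mass_le) auto
  ultimately show ?thesis by (auto elim!: eventually_mono)
qed

text \<open>The mass is monotone in the radius. These are the radii discarded by the a.e. quantifier
  of pmGH convergence.\<close>

lemma countable_not_isCont_mass:
  "countable {R. \<not> isCont (\<lambda>R. measure (m \<infinity>) (mball_of (X \<infinity>) (a \<infinity>) R)) R}"
  using fmeasurable_mball by (intro mono_ctble_discont monoI measure_mono_fmeasurable) auto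

end

section \<open>Distortion and weak convergence for Borel maps of vanishing displacement\<close>

locale approximating_maps = embedded_pmm_sequence +
  fixes R :: real and g :: "nat \<Rightarrow> 'a \<Rightarrow> 'a" and \<delta> :: "nat \<Rightarrow> real"
  assumes R_pos: "0 < R"
    and measurable_g: "g n \<in> metric_borel (X (enat n)) \<rightarrow>\<^sub>M metric_borel (X \<infinity>)"
    and \<delta>_tendsto: "\<delta> \<longlonglongrightarrow> 0"
    and g_near: "\<forall>\<^sub>F n in sequentially. \<forall>x\<in>mball_of (X (enat n)) (a (enat n)) R.
       d (\<iota> (enat n) x) (\<iota> \<infinity> (g n x)) < \<delta> n"
begin

abbreviation "B n \<equiv> mball_of (X n) (a n) R"

lemma g_in: "x \<in> mspace (X (enat n)) \<Longrightarrow> g n x \<in> mspace (X \<infinity>)"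
  using measurable_space[OF measurable_g] by simp

lemma measurable_g_m: "g n \<in> m (enat n) \<rightarrow>\<^sub>M metric_borel (X \<infinity>)"
  using measurable_g measurable_cong_sets[OF sets_m refl] by blast

text \<open>The embeddings are isometric, so both distances can be compared in \<open>Z\<close>,
  where each endpoint moves by less than \<open>e / 2\<close>.\<close>

lemma eventually_distortion_le:
  assumes "0 < e"
  shows "\<forall>\<^sub>F n in sequentially. \<forall>x\<in>B (enat n). \<forall>y\<in>B (enat n).
    \<bar>mdist (X (enat n)) x y - mdist (X \<infinity>) (g n x) (g n y)\<bar> \<le> e"
proof -
  have "\<forall>\<^sub>F n in sequentially. \<delta> n < e / 2"
    using \<delta>_tendsto assms by (intro order_tendstoD) auto
  then show ?thesis using g_near
  proof eventually_elim
    case (elim n)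
    show ?case
    proof (intro ballI)
      fix x y assume xy: "x \<in> B (enat n)" "y \<in> B (enat n)"
      let ?x = "\<iota> (enat n) x" and ?y = "\<iota> (enat n) y" and ?gx = "\<iota> \<infinity> (g n x)" and ?gy = "\<iota> \<infinity> (g n y)"
      have "d ?x ?gx < e / 2" "d ?y ?gy < e / 2" using elim xy by fastforce+
      moreover have "d ?x ?y \<le> d ?x ?gx + d ?gx ?gy + d ?gy ?y"
        "d ?gx ?gy \<le> d ?gx ?x + d ?x ?y + d ?y ?gy"
        using mdist_triangle[of ?x Z ?gx ?y] mdist_triangle[of ?gx Z ?gy ?y]
          mdist_triangle[of ?gx Z ?x ?gy] mdist_triangle[of ?x Z ?y ?gy] xy g_in
        by simp_all
      ultimately have "\<bar>d ?x ?y - d ?gx ?gy\<bar> \<le> e"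
        unfolding abs_le_iff by (simp add: mdist_commute[of Z ?gx] mdist_commute[of Z ?gy ?y])
      then show "\<bar>mdist (X (enat n)) x y - mdist (X \<infinity>) (g n x) (g n y)\<bar> \<le> e"
        using xy g_in by simp
    qed
  qed
qed

text \<open>First \<open>k\<close> is fixed so that the integral of \<open>F k\<close> over the
  limit space nearly reaches that of \<phi>, then \<open>n\<close> grows. The error \<open>e\<close>
  is shared equally by the choice of \<open>k\<close>, the weak convergence and the
  displacement.\<close>

lemma eventually_integral_ge:
  assumes cont: "continuous_map (mtopology_of (X \<infinity>)) euclideanreal \<phi>"
    and nonneg: "\<And>y. y \<in> mspace (X \<infinity>) \<Longrightarrow> 0 \<le> \<phi> y"
    and bd: "\<And>y. y \<in> mspace (X \<infinity>) \<Longrightarrow> \<phi> y \<le> M"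
    and "0 < e"
  shows "\<forall>\<^sub>F n in sequentially. (\<integral>x. indicator (B \<infinity>) x * \<phi> x \<partial>m \<infinity>) - e
    \<le> (\<integral>x. indicator (B (enat n)) x * \<phi> (g n x) \<partial>m (enat n))"
proof -
  \<comment> \<open>The minimum with \<open>M\<close> bounds the minorant far from the limit space.
    The cutoff radii increase to \<open>R\<close> and exhaust the open ball, while the margin
    \<open>inverse (real (Suc k))\<close> absorbs the motion of the base points.\<close>
  define F where "F k w = min M (lip_minorant (real k) \<phi> w) *
    ramp Z z\<^sub>0 (R - 2 * inverse (real (Suc k))) (R - inverse (real (Suc k))) w" for k w
  let ?I = "\<integral>x. indicator (B \<infinity>) x * \<phi> x \<partial>m \<infinity>"
  have lt: "R - 2 * inverse (real (Suc k)) < R - inverse (real (Suc k))" for k by simp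
  have M: "0 \<le> M" using nonneg[of "a \<infinity>"] bd[of "a \<infinity>"] by simp
  have L: "0 \<le> lip_minorant (real k) \<phi> w" for k w by (intro lip_minorant_nonneg nonneg) auto
  have contF: "continuous_map (mtopology_of Z) euclideanreal (F k)" for k
    unfolding F_def[abs_def]
    by (intro continuous_map_real_mult continuous_map_real_min continuous_map_lip_minorant
        continuous_map_ramp lt nonneg) auto
  have bdF: "\<bar>F k w\<bar> \<le> M" for k w
    using L[of k w] M ramp_nonneg[of Z z\<^sub>0 "R - 2 * inverse (real (Suc k))" "R - inverse (real (Suc k))" w]
      ramp_le_1[of Z z\<^sub>0 "R - 2 * inverse (real (Suc k))" "R - inverse (real (Suc k))" w]
      mult_mono[of "min M (lip_minorant (real k) \<phi> w)" M _ 1]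
    by (simp add: F_def abs_mult)
  have F_eq_0: "F k w = 0" if "R - inverse (real (Suc k)) \<le> d z\<^sub>0 w" for k w
    unfolding F_def ramp_eq_0[OF lt that] by simp
  have F_le: "F k w \<le> lip_minorant (real k) \<phi> w" for k w
    using L[of k w] M ramp_nonneg[of Z z\<^sub>0 "R - 2 * inverse (real (Suc k))" "R - inverse (real (Suc k))" w]
      ramp_le_1[of Z z\<^sub>0 "R - 2 * inverse (real (Suc k))" "R - inverse (real (Suc k))" w]
      mult_mono[of "min M (lip_minorant (real k) \<phi> w)" "lip_minorant (real k) \<phi> w" _ 1]
    by (simp add: F_def)
  note test = contF bdF F_eq_0[OF less_imp_le]
  note \<phi>_meas = continuous_map_imp_borel_measurable[OF cont]
  have inf_meas: "(\<lambda>x. x) \<in> m \<infinity> \<rightarrow>\<^sub>M metric_borel (X \<infinity>)"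
    by (rule measurable_ident_sets[OF sets_m])
  have abs: "\<bar>\<phi> y\<bar> \<le> M" if "y \<in> mspace (X \<infinity>)" for y using nonneg[OF that] bd[OF that] by simp
  have "(\<lambda>k. \<integral>x. F k (\<iota> \<infinity> x) \<partial>m \<infinity>) \<longlonglongrightarrow> ?I"
  proof (rule integral_dominated_convergence)
    show "(\<lambda>x. indicator (B \<infinity>) x * \<phi> x) \<in> borel_measurable (m \<infinity>)"
      using integrable_on_ball[OF \<phi>_meas abs inf_meas] by (rule borel_measurable_integrable)
    show "(\<lambda>x. F k (\<iota> \<infinity> x)) \<in> borel_measurable (m \<infinity>)" for k
      by (rule measurable_continuous_\<iota>[OF contF])
    show "integrable (m \<infinity>) (\<lambda>x. M * indicator (B \<infinity>) x)"
      by (intro integrable_mult_right fmeasurable_integrable_indicator fmeasurable_mball)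
    show "AE x in m \<infinity>. norm (F k (\<iota> \<infinity> x)) \<le> M * indicator (B \<infinity>) x" for k
    proof (intro AE_I2)
      fix x assume x: "x \<in> space (m \<infinity>)"
      show "norm (F k (\<iota> \<infinity> x)) \<le> M * indicator (B \<infinity>) x"
      proof (cases "x \<in> B \<infinity>")
        case False
        then have "R \<le> d z\<^sub>0 (\<iota> \<infinity> x)" using x by simp
        then have "F k (\<iota> \<infinity> x) = 0"
          by (intro F_eq_0) (smt (verit) inverse_positive_iff_positive of_nat_0_less_iff zero_less_Suc)
        then show ?thesis using False by simp
      qed (use bdF in simp)
    qed
    show "AE x in m \<infinity>. (\<lambda>k. F k (\<iota> \<infinity> x)) \<longlonglongrightarrow> indicator (B \<infinity>) x * \<phi> x"
    proof (intro AE_I2)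
      fix x assume "x \<in> space (m \<infinity>)"
      then have x: "x \<in> mspace (X \<infinity>)" by simp
      show "(\<lambda>k. F k (\<iota> \<infinity> x)) \<longlonglongrightarrow> indicator (B \<infinity>) x * \<phi> x"
      proof (cases "x \<in> B \<infinity>")
        case True
        have "(\<lambda>k. R - 2 * inverse (real (Suc k))) \<longlonglongrightarrow> R - 2 * 0"
          by (intro tendsto_intros LIMSEQ_inverse_real_of_nat)
        then have "\<forall>\<^sub>F k in sequentially. d z\<^sub>0 (\<iota> \<infinity> x) < R - 2 * inverse (real (Suc k))"
          using True by (intro order_tendstoD) auto
        then have "\<forall>\<^sub>F k in sequentially. min M (lip_minorant (real k) \<phi> (\<iota> \<infinity> x)) = F k (\<iota> \<infinity> x)"
        proof eventually_elim
          case (elim k)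
          show ?case
            unfolding F_def ramp_eq_1[OF lt less_imp_le[OF elim]] by simp
        qed
        moreover have "(\<lambda>k. min M (lip_minorant (real k) \<phi> (\<iota> \<infinity> x))) \<longlonglongrightarrow> min M (\<phi> x)"
          by (intro tendsto_min tendsto_const lip_minorant_tendsto cont nonneg x)
        ultimately have "(\<lambda>k. F k (\<iota> \<infinity> x)) \<longlonglongrightarrow> min M (\<phi> x)"
          by (rule Lim_transform_eventually[rotated])
        then show ?thesis using True bd[OF x] by simp
      next
        case False
        then have "R \<le> d z\<^sub>0 (\<iota> \<infinity> x)" using x by simp
        then have "F k (\<iota> \<infinity> x) = 0" for k
          by (intro F_eq_0) (smt (verit) inverse_positive_iff_positive of_nat_0_less_iff zero_less_Suc)
        then show ?thesis using False by simp
      qed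
    qed
  qed
  then have "\<forall>\<^sub>F k in sequentially. ?I - e / 3 < (\<integral>x. F k (\<iota> \<infinity> x) \<partial>m \<infinity>)"
    using \<open>0 < e\<close> by (intro order_tendstoD) auto
  then obtain k where k: "?I - e / 3 < (\<integral>x. F k (\<iota> \<infinity> x) \<partial>m \<infinity>)"
    using eventually_happens'[OF sequentially_bot] by blast
  \<comment> \<open>Radius \<open>R + 1\<close> and error 1 give a bound on the masses of the balls
    for all large \<open>n\<close>.\<close>
  define V where "V = measure (m \<infinity>) (mball_of (X \<infinity>) (a \<infinity>) (R + 1)) + 1"
  have "\<forall>\<^sub>F n in sequentially. (\<integral>x. F k (\<iota> \<infinity> x) \<partial>m \<infinity>) - e / 3 < (\<integral>x. F k (\<iota> (enat n) x) \<partial>m (enat n))"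
    using integral_test_tendsto[of z\<^sub>0, OF _ test] \<open>0 < e\<close> by (intro order_tendstoD) auto
  moreover have "\<forall>\<^sub>F n in sequentially. measure (m (enat n)) (B (enat n)) \<le> V"
    unfolding V_def by (rule eventually_ball_mass_le) auto
  moreover have "\<forall>\<^sub>F n in sequentially. real k * \<delta> n * V < e / 3"
  proof -
    have "(\<lambda>n. real k * \<delta> n * V) \<longlonglongrightarrow> real k * 0 * V"
      by (intro tendsto_intros \<delta>_tendsto)
    then show ?thesis using \<open>0 < e\<close> by (intro order_tendstoD) auto
  qed
  moreover have "\<forall>\<^sub>F n in sequentially. {x \<in> mspace (X (enat n)). d z\<^sub>0 (\<iota> (enat n) x)
      \<le> R - inverse (real (Suc k))} \<subseteq> B (enat n)"
    by (rule eventually_near_subset_ball) simp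
  ultimately show ?thesis using g_near
  proof eventually_elim
    case (elim n)
    \<comment> \<open>The displacement bound at the base point shows \<open>0 < \<delta> n\<close>,
      so that the mass bound may be multiplied by \<open>real k * \<delta> n\<close>.\<close>
    have a_in_B: "a (enat n) \<in> B (enat n)" using R_pos by simp
    have "d (\<iota> (enat n) (a (enat n))) (\<iota> \<infinity> (g n (a (enat n)))) < \<delta> n"
      using elim(5) a_in_B by blast
    then have \<delta>_pos: "0 < \<delta> n" by (rule order.strict_trans1[OF mdist_nonneg])
    note int_g = integrable_on_ball[OF \<phi>_meas abs measurable_g_m, of n "a (enat n)" R]
    have int_1: "integrable (m (enat n)) (\<lambda>x. real k * \<delta> n * indicator (B (enat n)) x)"
      by (intro integrable_mult_right fmeasurable_integrable_indicator fmeasurable_mball)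
    have "(\<integral>x. F k (\<iota> (enat n) x) \<partial>m (enat n))
       \<le> (\<integral>x. indicator (B (enat n)) x * \<phi> (g n x) + real k * \<delta> n * indicator (B (enat n)) x \<partial>m (enat n))"
    proof (intro integral_mono Bochner_Integration.integrable_add int_g int_1)
      show "integrable (m (enat n)) (\<lambda>x. F k (\<iota> (enat n) x))"
        by (rule integrable_test[of z\<^sub>0, OF _ test]) auto
      fix x assume "x \<in> space (m (enat n))"
      then have x: "x \<in> mspace (X (enat n))" by simp
      show "F k (\<iota> (enat n) x)
         \<le> indicator (B (enat n)) x * \<phi> (g n x) + real k * \<delta> n * indicator (B (enat n)) x"
      proof (cases "x \<in> B (enat n)")
        case True
        \<comment> \<open>The infimum defining the minorant is tested at
          \<open>g n x\<close>.\<close>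
        have "F k (\<iota> (enat n) x) \<le> \<phi> (g n x) + real k * d (\<iota> (enat n) x) (\<iota> \<infinity> (g n x))"
          using F_le[of k] lip_minorant_le[of "real k" \<phi> "g n x"] nonneg g_in[OF x]
          by (meson of_nat_0_le_iff order_trans)
        also have "\<dots> \<le> \<phi> (g n x) + real k * \<delta> n"
          using elim(5) True by (intro add_left_mono mult_left_mono[OF less_imp_le]) auto
        finally show ?thesis using True by simp
      next
        case False
        \<comment> \<open>Outside the ball both sides vanish, since the cutoff has already dropped
          to 0 there.\<close>
        then have "R - inverse (real (Suc k)) \<le> d z\<^sub>0 (\<iota> (enat n) x)"
          using elim(4) x by fastforce
        then show ?thesis using False by (simp add: F_eq_0)
      qed
    qed
    also have "\<dots> = (\<integral>x. indicator (B (enat n)) x * \<phi> (g n x) \<partial>m (enat n))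
        + real k * \<delta> n * measure (m (enat n)) (B (enat n) \<inter> mspace (X (enat n)))"
      using int_g int_1 by simp
    also have "B (enat n) \<inter> mspace (X (enat n)) = B (enat n)" by auto
    also have "real k * \<delta> n * measure (m (enat n)) (B (enat n)) \<le> real k * \<delta> n * V"
      using elim(2) \<delta>_pos by (intro mult_left_mono) auto
    finally show ?case using elim(1,3) k by linarith
  qed
qed

lemma integral_tendsto:
  assumes cont: "continuous_map (mtopology_of (X \<infinity>)) euclideanreal \<phi>"
    and bd: "\<And>y. y \<in> mspace (X \<infinity>) \<Longrightarrow> \<bar>\<phi> y\<bar> \<le> M"
    and isCont: "isCont (\<lambda>R. measure (m \<infinity>) (mball_of (X \<infinity>) (a \<infinity>) R)) R"
  shows "(\<lambda>n. \<integral>x. indicator (B (enat n)) x * \<phi> (g n x) \<partial>m (enat n))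
    \<longlonglongrightarrow> (\<integral>x. indicator (B \<infinity>) x * \<phi> x \<partial>m \<infinity>)"
proof (rule LIMSEQ_I)
  fix r :: real assume "0 < r"
  have M: "0 \<le> M" using bd[of "a \<infinity>"] by simp
  \<comment> \<open>The lower bound costs \<open>e\<close> and the mass bound costs
    \<open>M * e\<close>, together less than \<open>r\<close>.\<close>
  define e where "e = r / (M + 2)"
  have e: "0 < e" "(M + 1) * e < r" using \<open>0 < r\<close> M by (auto simp: e_def field_simps)
  note \<phi>_meas = continuous_map_imp_borel_measurable[OF cont]
  have inf_meas: "(\<lambda>x. x) \<in> m \<infinity> \<rightarrow>\<^sub>M metric_borel (X \<infinity>)"
    by (rule measurable_ident_sets[OF sets_m])
  have split: "(\<integral>x. indicator (B n) x * (M + s * \<phi> (h x)) \<partial>m n) =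
      M * measure (m n) (B n) + s * (\<integral>x. indicator (B n) x * \<phi> (h x) \<partial>m n)"
    if h: "h \<in> m n \<rightarrow>\<^sub>M metric_borel (X \<infinity>)" for n h s
  proof -
    have "(\<integral>x. indicator (B n) x * (M + s * \<phi> (h x)) \<partial>m n)
      = (\<integral>x. M * indicator (B n) x + s * (indicator (B n) x * \<phi> (h x)) \<partial>m n)"
      by (simp add: algebra_simps)
    also have "\<dots> = M * measure (m n) (B n \<inter> mspace (X n)) + s * (\<integral>x. indicator (B n) x * \<phi> (h x) \<partial>m n)"
      using integrable_on_ball[OF \<phi>_meas bd h, of "a n" R]
        fmeasurable_integrable_indicator[OF fmeasurable_mball[of n "a n" R]]
      by (subst Bochner_Integration.integral_add) auto
    also have "B n \<inter> mspace (X n) = B n" by auto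
    finally show ?thesis .
  qed
  \<comment> \<open>Both signs give a function with values between 0 and
    \<open>2 * M\<close>.\<close>
  have ge: "\<forall>\<^sub>F n in sequentially. (\<integral>x. indicator (B \<infinity>) x * (M + s * \<phi> x) \<partial>m \<infinity>) - e
    \<le> (\<integral>x. indicator (B (enat n)) x * (M + s * \<phi> (g n x)) \<partial>m (enat n))" if s: "s = 1 \<or> s = -1" for s
  proof (rule eventually_integral_ge[where M = "2 * M" and \<phi> = "\<lambda>x. M + s * \<phi> x"])
    show "continuous_map (mtopology_of (X \<infinity>)) euclideanreal (\<lambda>x. M + s * \<phi> x)"
      using cont by (intro continuous_map_add continuous_map_real_mult) auto
  qed (use s bd e in \<open>fastforce simp: abs_le_iff\<close>)+
  note ge' = ge[unfolded split[OF measurable_g_m] split[OF inf_meas]]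
  show "\<exists>N. \<forall>n\<ge>N. norm ((\<integral>x. indicator (B (enat n)) x * \<phi> (g n x) \<partial>m (enat n))
      - (\<integral>x. indicator (B \<infinity>) x * \<phi> x \<partial>m \<infinity>)) < r"
    unfolding eventually_sequentially[symmetric]
    using ge'[OF disjI1[OF refl]] ge'[OF disjI2[OF refl]] eventually_ball_mass_le_isCont[OF isCont e(1)]
  proof eventually_elim
    case (elim n)
    \<comment> \<open>The upper bound on the mass turns each lower bound on \<open>M\<close> times
      the mass plus \<open>s\<close> times the integral into one on \<open>s\<close> times the
      integral; the two signs then bound the integral from both sides.\<close>
    have "M * measure (m (enat n)) (B (enat n)) \<le> M * (measure (m \<infinity>) (B \<infinity>) + e)"
      using elim(3) M by (rule mult_left_mono)
    then show ?case using elim(1,2) e(2) by (simp add: algebra_simps abs_less_iff)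
  qed
qed

lemma weakly_converges_restricted:
  assumes "isCont (\<lambda>R. measure (m \<infinity>) (mball_of (X \<infinity>) (a \<infinity>) R)) R"
  shows "weakly_converges (X \<infinity>)
    (\<lambda>n. distr (restrict_space (m (enat n)) (B (enat n))) (metric_borel (X \<infinity>)) (g n))
    (density (m \<infinity>) (indicator (B \<infinity>)))"
  unfolding weakly_converges_def
proof (intro allI impI, elim conjE)
  fix \<phi> :: "'a \<Rightarrow> real"
  assume cont: "continuous_map (mtopology_of (X \<infinity>)) euclideanreal \<phi>"
    and "bounded (\<phi> ` mspace (X \<infinity>))"
  then obtain M where M: "\<And>y. y \<in> mspace (X \<infinity>) \<Longrightarrow> \<bar>\<phi> y\<bar> \<le> M"
    by (auto simp: bounded_iff)
  note \<phi>_meas = continuous_map_imp_borel_measurable[OF cont]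
  have "\<phi> \<in> borel_measurable (m \<infinity>)"
    using \<phi>_meas measurable_cong_sets[OF sets_m refl] by blast
  moreover have B_sets: "B n \<in> sets (m n)" for n using fmeasurable_mball by blast
  moreover have "density (m \<infinity>) (indicator (B \<infinity>)) = density (m \<infinity>) (\<lambda>x. ennreal (indicator (B \<infinity>) x))"
    by (simp add: ennreal_indicator)
  ultimately have "integral\<^sup>L (density (m \<infinity>) (indicator (B \<infinity>))) \<phi>
      = (\<integral>x. indicator (B \<infinity>) x * \<phi> x \<partial>m \<infinity>)"
    by (simp add: integral_density)
  moreover have "integral\<^sup>L (distr (restrict_space (m (enat n)) (B (enat n))) (metric_borel (X \<infinity>)) (g n)) \<phi>
      = (\<integral>x. indicator (B (enat n)) x * \<phi> (g n x) \<partial>m (enat n))" for n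
    unfolding integral_distr[OF measurable_restrict_space1[OF measurable_g_m] \<phi>_meas]
    using B_sets by (subst integral_restrict_space) (simp_all add: sets.Int_space_eq2 del: space_m)
  ultimately show "(\<lambda>n. integral\<^sup>L (distr (restrict_space (m (enat n)) (B (enat n)))
        (metric_borel (X \<infinity>)) (g n)) \<phi>)
      \<longlonglongrightarrow> integral\<^sup>L (density (m \<infinity>) (indicator (B \<infinity>))) \<phi>"
    using integral_tendsto[OF cont M assms] by simp
qed

end

section \<open>Covering of limit balls, and assembly of the pmGH data\<close>

context doubling_pmm_sequence
begin

text \<open>A finite net reduces the uniform claim to finitely many points, each of which is
  eventually approximated from \<open>X n\<close>.\<close>

lemma eventually_covering:
  assumes "approximating_maps X m a Z \<iota> R g \<delta>" and "0 < e"
  shows "\<forall>\<^sub>F n in sequentially. mball_of (X \<infinity>) (a \<infinity>) (R - e)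
    \<subseteq> (\<Union>x\<in>mball_of (X (enat n)) (a (enat n)) R. mball_of (X \<infinity>) (g n x) e)"
proof -
  interpret approximating_maps X m a Z \<iota> R g \<delta> by fact
  \<comment> \<open>From \<open>g n x\<close> to \<open>y\<close> there are three steps, via
    \<open>x\<close> and the net point \<open>s\<close>, each below \<open>e / 4\<close>. From the
    base point to \<open>x\<close> the loss is two such steps, so \<open>x\<close> stays within
    \<open>R - e / 2\<close>.\<close>
  have e4: "0 < e / 4" using \<open>0 < e\<close> by simp
  obtain S where S: "finite S" "S \<subseteq> mball_of (X \<infinity>) (a \<infinity>) (R - e)"
    "\<And>y. y \<in> mball_of (X \<infinity>) (a \<infinity>) (R - e) \<Longrightarrow> \<exists>s\<in>S. mdist (X \<infinity>) s y < e / 4"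
    using limit_ball_finite_net[OF e4, of "R - e"] by auto
  have "\<forall>\<^sub>F n in sequentially. \<forall>s\<in>S. \<exists>x\<in>mspace (X (enat n)). d (\<iota> \<infinity> s) (\<iota> (enat n) x) < e / 4"
    using S(1,2) eventually_approximable[OF _ e4] by (intro eventually_ball_finite) auto
  moreover have "\<forall>\<^sub>F n in sequentially. \<delta> n < e / 4"
    using \<delta>_tendsto e4 by (intro order_tendstoD) auto
  ultimately show ?thesis using eventually_base_near[OF e4] g_near
  proof eventually_elim
    case (elim n)
    show ?case
    proof
      fix y assume y: "y \<in> mball_of (X \<infinity>) (a \<infinity>) (R - e)"
      then obtain s where s: "s \<in> S" "mdist (X \<infinity>) s y < e / 4" using S(3) by blast
      then obtain x where x: "x \<in> mspace (X (enat n))" "d (\<iota> \<infinity> s) (\<iota> (enat n) x) < e / 4"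
        using elim(1) by blast
      have s_in: "s \<in> mspace (X \<infinity>)" "mdist (X \<infinity>) (a \<infinity>) s < R - e" using s S(2) by auto
      let ?a = "\<iota> (enat n) (a (enat n))" and ?x = "\<iota> (enat n) x"
      have "d ?a ?x \<le> d z\<^sub>0 ?a + d z\<^sub>0 (\<iota> \<infinity> s) + d (\<iota> \<infinity> s) ?x"
        using mdist_triangle[of ?a Z z\<^sub>0 ?x] mdist_triangle[of z\<^sub>0 Z "\<iota> \<infinity> s" ?x] x s_in
        by (simp add: mdist_commute)
      then have xB: "x \<in> mball_of (X (enat n)) (a (enat n)) R"
        using x s_in elim(3) \<open>0 < e\<close> by simp
      have gx: "g n x \<in> mspace (X \<infinity>)" "d ?x (\<iota> \<infinity> (g n x)) < \<delta> n"
        using g_in[OF x(1)] elim(4) xB by auto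
      have "d (\<iota> \<infinity> (g n x)) (\<iota> \<infinity> y) \<le> d ?x (\<iota> \<infinity> (g n x)) + d (\<iota> \<infinity> s) ?x + d (\<iota> \<infinity> s) (\<iota> \<infinity> y)"
        using mdist_triangle[of "\<iota> \<infinity> (g n x)" Z ?x "\<iota> \<infinity> y"]
          mdist_triangle[of ?x Z "\<iota> \<infinity> s" "\<iota> \<infinity> y"] x gx s_in y
        by (simp add: mdist_commute)
      then have "mdist (X \<infinity>) (g n x) y < e"
        using gx x s s_in elim(2) y \<open>0 < e\<close> by simp
      then show "y \<in> (\<Union>x\<in>mball_of (X (enat n)) (a (enat n)) R. mball_of (X \<infinity>) (g n x) e)"
        using xB gx y by auto
    qed
  qed
qed

text \<open>The maps depend on \<open>R\<close> only, and \<epsilon> enters through the threshold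
  \<open>N\<close> alone. Hence the weak convergence is one statement for all \<epsilon>.\<close>

lemma pmGH_converges: "pmGH_converges X m a"
proof -
  have "\<exists>g \<delta>. approximating_maps X m a Z \<iota> R g \<delta> \<and> (\<forall>n. g n (a (enat n)) = a \<infinity>)" if "0 < R" for R
  proof -
    obtain g \<delta> where "\<And>n. g n \<in> metric_borel (X (enat n)) \<rightarrow>\<^sub>M metric_borel (X \<infinity>)"
      "\<And>n. g n (a (enat n)) = a \<infinity>" "\<delta> \<longlonglongrightarrow> 0"
      "\<forall>\<^sub>F n in sequentially. \<forall>x\<in>mball_of (X (enat n)) (a (enat n)) R.
         d (\<iota> (enat n) x) (\<iota> \<infinity> (g n x)) < \<delta> n"
      by (rule ex_borel_approximation[where R = R]) (rule that)
    then show ?thesis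
      using that by (intro exI[of _ g] exI[of _ \<delta>] conjI approximating_maps.intro
        approximating_maps_axioms.intro embedded_pmm_sequence_axioms) auto
  qed
  then obtain g \<delta> where maps: "\<And>R. 0 < R \<Longrightarrow> approximating_maps X m a Z \<iota> R (g R) (\<delta> R)"
    and base: "\<And>R n. 0 < R \<Longrightarrow> g R n (a (enat n)) = a \<infinity>"
    by metis
  define good where "good e R n \<longleftrightarrow>
    (\<forall>x\<in>mball_of (X (enat n)) (a (enat n)) R. \<forall>y\<in>mball_of (X (enat n)) (a (enat n)) R.
      \<bar>mdist (X (enat n)) x y - mdist (X \<infinity>) (g R n x) (g R n y)\<bar> \<le> e) \<and>
    mball_of (X \<infinity>) (a \<infinity>) (R - e)
      \<subseteq> (\<Union>x\<in>mball_of (X (enat n)) (a (enat n)) R. mball_of (X \<infinity>) (g R n x) e)" for e R n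
  have "\<forall>\<^sub>F n in sequentially. good e R n" if "0 < e" "0 < R" for e R
    unfolding good_def
    using approximating_maps.eventually_distortion_le[OF maps[OF that(2)] that(1)]
      eventually_covering[OF maps[OF that(2)] that(1)]
    by (rule eventually_conj)
  then obtain N where N: "\<And>e R n. 0 < e \<Longrightarrow> 0 < R \<Longrightarrow> N e R \<le> n \<Longrightarrow> good e R n"
    unfolding eventually_sequentially by metis
  have "AE R in lborel. R > 0 \<longrightarrow> weakly_converges (X \<infinity>)
      (\<lambda>n. distr (restrict_space (m (enat n)) (mball_of (X (enat n)) (a (enat n)) R))
        (metric_borel (X \<infinity>)) (g R n))
      (density (m \<infinity>) (indicator (mball_of (X \<infinity>) (a \<infinity>) R)))"
    \<comment> \<open>The exceptional radii depend only on the limit measure, not on the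
      maps.\<close>
    using AE_not_in[OF countable_imp_null_set_lborel[OF countable_not_isCont_mass]]
    by eventually_elim (simp add: approximating_maps.weakly_converges_restricted[OF maps])
  moreover have "g R n \<in> restrict_space (metric_borel (X (enat n))) (mball_of (X (enat n)) (a (enat n)) R)
      \<rightarrow>\<^sub>M metric_borel (X \<infinity>)" if "0 < R" for R n
    by (intro measurable_restrict_space1 approximating_maps.measurable_g[OF maps[OF that]])
  ultimately show ?thesis
    using N base unfolding pmGH_converges_def good_def Let_def
    by (intro exI[of _ N] exI[of _ "\<lambda>n R e. g R n"]) blast
qed

end

theorem proposition3p33:
  fixes X :: "enat \<Rightarrow> 'a metric"
    and m :: "enat \<Rightarrow> 'a measure"
    and a :: "enat \<Rightarrow> 'a"
  assumes "\<And>n. pmm_space (X n) (m n) (a n)"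
    and "pmG_converges TYPE('z) X m a"
    and "metric_support (X \<infinity>) (m \<infinity>) = mspace (X \<infinity>)"
    and "\<exists>c>0. \<forall>n. doubling c (X n) (m n)"
  shows "pmGH_converges X m a"
proof -
  obtain Z :: "'z metric" and \<iota> where "embedded_pmm_sequence X m a Z \<iota>"
    using assms(1,2) unfolding pmG_converges_def embedded_pmm_sequence_def by blast
  moreover obtain c where "0 < c" "\<And>n. doubling c (X n) (m n)"
    using assms(4) by blast
  ultimately interpret doubling_pmm_sequence X m a Z \<iota> c
    using assms(3) by (simp add: doubling_pmm_sequence_def doubling_pmm_sequence_axioms_def)
  show ?thesis by (rule pmGH_converges)
qed

end
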